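(* Let $D$ be a Dedekind domain with finite residue fields, with fraction field $K$, and let $n\ge 2$. Let $P$ be a nonzero prime of $D$. Let $V=D_P$ and let $F\in K[x]$ be the polynomial given by the construction described in the context, applied to $V$ (and $n$). Then there exists $c\in D\setminus P$ such that $cF$ is properly integral over $\mathrm{Int}_K(M_n(D))$. In particular, if $P$ is principal, then we can take $c=1$.
   Context: $M_n(D)$ is the ring of $n\times n$ matrices with entries in $D$, and $\mathrm{Int}_K(M_n(D))=\{f\in K[x]\mid f(M_n(D))\subseteq M_n(D)\}$, with evaluation in $M_n(K)$. A polynomial $f\in K[x]$ is called properly integral over $\mathrm{Int}_K(M_n(D))$ if $f$ lies in the integral closure of $\mathrm{Int}_K(M_n(D))$ (in its field of fractions $K(x)$) but $f\notin\mathrm{Int}_K(M_n(D))$. Construction of $F$. Let $V$ be a discrete valuation ring with maximal ideal $\pi V$, field of fractions $K$, and finite residue field $V/\pi V\cong\mathbb{F}_q$ (here $V=D_P$). Elements of $\mathbb{F}_q$ and of $\mathbb{F}_q[x]$ are lifted to $V$ and $V[x]$ respectively: one first picks residue representatives in $V$ and $V[x]$ and uses these in all calculations over $V$; to ease notation the representatives are denoted by the same symbols, and one still writes $\mathbb{F}_q$ and $\mathbb{F}_q^\times$ for the corresponding sets of representatives. Let $$\mathscr{P}=\{f\in\mathbb{F}_q[x]\mid f\text{ is monic, irreducible, and }2\le\deg f\le n\},$$ $$\theta(x)=\prod_{f\in\mathscr{P}}f(x)^{\lfloor n/\deg f\rfloor},\qquad h(x)=x^{n-1}\prod_{a\in\mathbb{F}_q^\times}(x^n+\pi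 a),$$ $$H(x)=\prod_{b\in\mathbb{F}_q}h(x-b),\qquad F(x)=\frac{H(x)\,(\theta(x))^q}{\pi^q}.$$
   Formalization: For principal P, c = 1 is proved when π is a generator of P and all residue representatives are chosen in D and D[x] (such choices are shown to exist); for arbitrary choices in V it fails, e.g. D = Z, P = 2Z, n = 2, π = 2, representatives {0, 1/3} give F(1) = 25/9. *)

theory Defs
  imports
    "HOL-Library.Cardinality"
    "HOL-Algebra.Ring_Divisibility"
    "HOL-Computational_Algebra.Polynomial_Factorial"
    "Jordan_Normal_Form.Matrix"
begin

hide_const (open) Divisibility.irreducible Divisibility.prime
  UnivPoly.coeff UnivPoly.monom

text \<open>
  The Dedekind domain $D$ is the type \<open>'d\<close>, its field of fractions $K$ is \<open>'d fract\<close>, and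
  $K(x)$ is \<open>'d fract poly fract\<close>. Subrings of a type class ring (such as $D_P$ in $K$) are viewed
  as structures of HOL-Algebra in order to use its notions of ideals and quotients.
\<close>

definition ring_on :: "'a::comm_ring_1 set \<Rightarrow> 'a ring" where
  "ring_on S = \<lparr>carrier = S, mult = (*), one = 1, zero = 0, add = (+)\<rparr>"

definition integral_over :: "'a::comm_ring_1 set \<Rightarrow> 'a \<Rightarrow> bool" where
  "integral_over R x \<longleftrightarrow> (\<exists>p. lead_coeff p = 1 \<and> (\<forall>i. coeff p i \<in> R) \<and> poly p x = 0)"

text \<open>Fields count as Dedekind domains here; they have no nonzero prime ideal.\<close>

definition dedekind_domain :: "'d::idom itself \<Rightarrow> bool" where
  "dedekind_domain _ \<longleftrightarrow>
     noetherian_domain (ring_on (UNIV :: 'd set)) \<and>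
     (\<forall>x :: 'd fract. integral_over (range to_fract) x \<longrightarrow> x \<in> range to_fract) \<and>
     (\<forall>Q :: 'd set. primeideal Q (ring_on UNIV) \<and> Q \<noteq> {0} \<longrightarrow> maximalideal Q (ring_on UNIV))"

definition finite_residue_fields :: "'d::idom itself \<Rightarrow> bool" where
  "finite_residue_fields _ \<longleftrightarrow>
     (\<forall>Q :: 'd set. primeideal Q (ring_on UNIV) \<and> Q \<noteq> {0} \<longrightarrow>
        finite (carrier (ring_on (UNIV :: 'd set) Quot Q)))"

definition localization_at :: "'d::idom set \<Rightarrow> 'd fract set" where
  "localization_at P = {to_fract a / to_fract s | a s. s \<notin> P}"

definition eval_mat :: "'a::comm_ring_1 poly \<Rightarrow> 'a mat \<Rightarrow> 'a mat" where
  "eval_mat f A = mat (dim_row A) (dim_row A)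
     (\<lambda>(i, j). \<Sum>k\<le>degree f. coeff f k * (A ^\<^sub>m k) $$ (i, j))"

definition matrices_over :: "nat \<Rightarrow> 'a set \<Rightarrow> 'a mat set" where
  "matrices_over n S = {A \<in> carrier_mat n n. elements_mat A \<subseteq> S}"

text \<open>$\mathrm{Int}_K(M_n(D))$\<close>

definition Int_mat :: "nat \<Rightarrow> 'd::idom fract poly set" where
  "Int_mat n = {f. \<forall>A \<in> matrices_over n (range to_fract).
                     eval_mat f A \<in> matrices_over n (range to_fract)}"

definition properly_integral_Int_mat :: "nat \<Rightarrow> 'd::idom fract poly \<Rightarrow> bool" where
  "properly_integral_Int_mat n f \<longleftrightarrow>
     integral_over (to_fract ` Int_mat n) (to_fract f) \<and> f \<notin> Int_mat n"

text \<open>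
  The residue field of a local ring $V$ is given by a surjective ring homomorphism \<open>res\<close> from $V$
  onto a field type \<open>'f\<close>; since $V$ is local, its kernel is the maximal ideal of $V$. The values
  of \<open>res\<close> outside $V$ are irrelevant.
\<close>

definition residue_map :: "'k::field set \<Rightarrow> ('k \<Rightarrow> 'f::field) \<Rightarrow> bool" where
  "residue_map V res \<longleftrightarrow> res \<in> Ring.ring_hom (ring_on V) (ring_on UNIV) \<and> res ` V = UNIV"

definition uniformizer :: "'k::field set \<Rightarrow> 'k \<Rightarrow> bool" where
  "uniformizer V \<pi> \<longleftrightarrow> \<pi> \<in> V \<and> maximalideal (PIdl\<^bsub>ring_on V\<^esub> \<pi>) (ring_on V)"

text \<open>
  Choices of representatives, taken in a set \<open>S\<close> (which is $V$, or $D$), for the elements of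
  $\mathbb{F}_q$ and of $\mathbb{F}_q[x]$. The representative of $0$ need not be $0$, and the
  representatives of polynomials need not preserve degrees or be compatible with those of the
  elements of $\mathbb{F}_q$.
\<close>

definition residue_lift :: "'k::field set \<Rightarrow> ('k \<Rightarrow> 'f::field) \<Rightarrow> ('f \<Rightarrow> 'k) \<Rightarrow> bool" where
  "residue_lift S res rep \<longleftrightarrow> (\<forall>a. rep a \<in> S \<and> res (rep a) = a)"

definition residue_poly_lift ::
    "'k::field set \<Rightarrow> ('k \<Rightarrow> 'f::field) \<Rightarrow> ('f poly \<Rightarrow> 'k poly) \<Rightarrow> bool" where
  "residue_poly_lift S res prep \<longleftrightarrow>
     (\<forall>f i. coeff (prep f) i \<in> S \<and> res (coeff (prep f) i) = coeff f i)"

definition irred_polys :: "nat \<Rightarrow> 'f::field poly set" where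
  "irred_polys n =
     {f. lead_coeff f = 1 \<and> Factorial_Ring.irreducible f \<and> 2 \<le> degree f \<and> degree f \<le> n}"

definition theta_poly :: "nat \<Rightarrow> ('f::{field,finite} poly \<Rightarrow> 'k::field poly) \<Rightarrow> 'k poly" where
  "theta_poly n prep = (\<Prod>f\<in>irred_polys n. prep f ^ (n div degree f))"

definition h_poly :: "nat \<Rightarrow> 'k::field \<Rightarrow> ('f::{field,finite} \<Rightarrow> 'k) \<Rightarrow> 'k poly" where
  "h_poly n \<pi> rep = monom 1 (n - 1) * (\<Prod>a\<in>UNIV - {0}. monom 1 n + [:\<pi> * rep a:])"

definition H_poly :: "nat \<Rightarrow> 'k::field \<Rightarrow> ('f::{field,finite} \<Rightarrow> 'k) \<Rightarrow> 'k poly" where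
  "H_poly n \<pi> rep = (\<Prod>b\<in>UNIV. pcompose (h_poly n \<pi> rep) [:- rep b, 1:])"

definition F_poly ::
    "nat \<Rightarrow> 'k::field \<Rightarrow> ('f::{field,finite} \<Rightarrow> 'k) \<Rightarrow> ('f poly \<Rightarrow> 'k poly) \<Rightarrow> 'k poly" where
  "F_poly n \<pi> rep prep =
     smult (1 / \<pi> ^ CARD('f)) (H_poly n \<pi> rep * theta_poly n prep ^ CARD('f))"

text \<open>
  If $P$ is principal, then one can choose a generator of $P$ as \<open>\<pi>\<close> and all representatives
  in $D$ and $D[x]$.
\<close>

definition choices_in_base ::
    "'d::idom set \<Rightarrow> ('d fract \<Rightarrow> 'f::field) \<Rightarrow> 'd fract \<Rightarrow> ('f \<Rightarrow> 'd fract) \<Rightarrow>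
     ('f poly \<Rightarrow> 'd fract poly) \<Rightarrow> bool" where
  "choices_in_base P res \<pi> rep prep \<longleftrightarrow>
     (\<exists>p. P = PIdl\<^bsub>ring_on UNIV\<^esub> p \<and> \<pi> = to_fract p) \<and>
     residue_lift (range to_fract) res rep \<and>
     residue_poly_lift (range to_fract) res prep"

end

theory Submission
  imports Defs "Jordan_Normal_Form.Char_Poly"
begin

text \<open>
  Let \<open>V = D\<^sub>P\<close>, let \<open>q\<close> be the order of the residue field, and write \<open>F = G / \<pi>^q\<close> with \<open>G\<close> in
  \<open>V[x]\<close>. The whole argument takes place in polynomial rings over \<open>K\<close>; neither valuations of
  extension fields nor completions enter.

  \<^bold>\<open>Not integer-valued.\<close> At the nilpotent Jordan block \<open>N\<close>, the corner entry of \<open>f(N)\<close> is the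
  coefficient of \<open>x^(n-1)\<close> in \<open>f\<close> (\<open>coeff_mem_if_Int_mat\<close>). Modulo \<open>x^n\<close> and \<open>\<pi>^q\<close>, the factor
  \<open>h(x - b)\<close> of \<open>G\<close> for \<open>b = 0\<close> is \<open>\<pi>^(q-1) x^(n-1)\<close> times a unit, and the other factors of \<open>G\<close>
  have unit constant terms. So this coefficient of \<open>F\<close> is a unit divided by \<open>\<pi>\<close>, up to an element
  of \<open>V\<close> (\<open>F_poly_not_integral\<close>).

  \<^bold>\<open>Integral over the integer-valued polynomials.\<close> It is enough to find a monic polynomial
  \<open>\<psi>\<close> of positive degree over \<open>D\<close> such that \<open>\<psi>(cF)\<close> is integer-valued: then \<open>cF\<close> is a root of
  \<open>\<psi>(X) - \<psi>(cF)\<close>. The polynomial \<open>\<psi>(X) = \<Prod>r s. (X^2 - r X - s)^n\<close> does this, where \<open>r\<close> and \<open>s\<close> run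
  over representatives in \<open>D\<close> of the residue field. To see that \<open>\<psi>(cF)\<close> is integral at a matrix
  \<open>A\<close> over \<open>V\<close> with characteristic polynomial \<open>\<chi>\<close>, consider the ring \<open>\<Phi>\<close> of all \<open>f\<close> in
  \<open>K[x]\<close> for which \<open>f(A)\<close> has entries in \<open>V\<close>. It contains \<open>V[x]\<close> and, by Cayley--Hamilton, all of
  \<open>\<chi> K[x]\<close>; nothing else about \<open>A\<close> is used (locale \<open>integral_at\<close>).

  \<^item> If \<open>\<chi>\<close> is not congruent modulo \<open>\<pi>\<close> to any \<open>(x - b)^n\<close>, then \<open>F\<close> itself lies in \<open>\<Phi>\<close>. For
    an irreducible factor \<open>f\<close> of \<open>\<chi>\<close> modulo \<open>\<pi>\<close>, write \<open>\<chi> = f^k u\<close> modulo \<open>\<pi>\<close> with \<open>u\<close> prime to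
    \<open>f\<close>. The exponents in \<open>h\<close> and \<open>\<theta>\<close> are such that \<open>u^q G\<close> lies in \<open>\<pi>^q \<Phi>\<close>, because
    \<open>k deg f \<le> n\<close>, and even \<open>k \<le> n - 1\<close> if \<open>f\<close> is linear. These \<open>u^q\<close> generate the unit ideal modulo
    \<open>\<pi>\<close>, so that \<open>(1 - \<pi> r) G\<close> lies in \<open>\<pi>^q \<Phi>\<close> for some \<open>r\<close>, hence so does \<open>G\<close>
    (\<open>F_poly_integral_if_nonlocal\<close>).
  \<^item> Otherwise put \<open>y = x - b\<close> and \<open>y^n = \<chi> - \<pi> (y R + \<rho>)\<close> with a constant \<open>\<rho>\<close>. If \<open>\<rho>\<close> is a unit, one
    factor \<open>y^n + \<pi> a\<close> of \<open>h(y)\<close> is so small that \<open>F\<close> is in \<open>\<Phi>\<close> again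
    (\<open>F_poly_integral_if_ramified\<close>).
  \<^item> If \<open>\<rho> = \<pi> \<epsilon>\<close>, then \<open>F\<close> need not be in \<open>\<Phi>\<close>, but it is a multiple of \<open>T = y^(n-1) / \<pi>\<close> in
    \<open>V[x]\<close> modulo \<open>\<chi> K[x]\<close>, and \<open>T^2 = - R T - \<epsilon> y^(n-2)\<close> modulo \<open>\<chi> K[x]\<close>. So
    \<open>S = V[x] + V[x] T + \<chi> K[x]\<close> is a ring, \<open>\<pi> S \<subseteq> \<Phi>\<close>, and \<open>cF\<close> satisfies a monic quadratic
    equation over \<open>V[x]\<close>. Modulo the ideal \<open>y S + \<pi> S\<close> its coefficients become elements \<open>r\<close> and
    \<open>s\<close> of the residue field, and the \<open>n\<close>-th power of an element of that ideal is in \<open>\<pi> S\<close> since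
    \<open>y^n\<close> is (\<open>F_poly_root_if_wild\<close>).

  \<^bold>\<open>From \<open>V\<close> to \<open>D\<close>.\<close> Let \<open>W\<close> be the ring of elements of \<open>K\<close> that are integral away from \<open>P\<close>. Then
  \<open>V \<inter> W = D\<close>, and a Noetherian induction over ideals provides \<open>c \<notin> P\<close> with \<open>cF\<close> in \<open>W[x]\<close>
  (\<open>clear_denominators\<close>). Then \<open>\<psi>(cF)\<close> takes values with entries in \<open>V\<close> and in \<open>W\<close>, hence in
  \<open>D\<close>. If \<open>P = (\<pi>)\<close> and all representatives are chosen in \<open>D\<close>, then \<open>F\<close> is in \<open>W[x]\<close> already, and
  \<open>c = 1\<close> works.
\<close>

section \<open>Subrings of a commutative ring\<close>

text \<open>
  Subrings are sets in a type class ring, so that membership is the only thing to track in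
  computations; \<open>ideal_ring_on_iff\<close> connects them with the ideals of the structures \<open>ring_on S\<close>.
\<close>

locale unital_subring =
  fixes S :: "'a::comm_ring_1 set"
  assumes one_mem [simp]: "1 \<in> S"
    and diff_mem: "x \<in> S \<Longrightarrow> y \<in> S \<Longrightarrow> x - y \<in> S"
    and mult_mem: "x \<in> S \<Longrightarrow> y \<in> S \<Longrightarrow> x * y \<in> S"
begin

lemma zero_mem [simp]: "0 \<in> S"
  using diff_mem[of 1 1] by simp

lemma uminus_mem: "x \<in> S \<Longrightarrow> - x \<in> S"
  using diff_mem[of 0 x] by simp

lemma add_mem: "x \<in> S \<Longrightarrow> y \<in> S \<Longrightarrow> x + y \<in> S"
  using diff_mem[of x "- y"] uminus_mem[of y] by simp

lemma sum_mem: "(\<And>i. i \<in> I \<Longrightarrow> f i \<in> S) \<Longrightarrow> sum f I \<in> S"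
  by (induction I rule: infinite_finite_induct) (auto intro: add_mem)

lemma prod_mem: "(\<And>i. i \<in> I \<Longrightarrow> f i \<in> S) \<Longrightarrow> prod f I \<in> S"
  by (induction I rule: infinite_finite_induct) (auto intro: mult_mem)

lemma power_mem: "x \<in> S \<Longrightarrow> x ^ k \<in> S"
  by (induction k) (auto intro: mult_mem)

lemma cring_ring_on: "cring (ring_on S)"
proof (rule cringI)
  show "abelian_group (ring_on S)"
  proof (rule abelian_groupI)
    fix x assume "x \<in> carrier (ring_on S)"
    then show "\<exists>y\<in>carrier (ring_on S). y \<oplus>\<^bsub>ring_on S\<^esub> x = \<zero>\<^bsub>ring_on S\<^esub>"
      by (intro bexI[of _ "- x"]) (auto simp: ring_on_def uminus_mem)
  qed (auto simp: ring_on_def add_mem algebra_simps)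
  show "comm_monoid (ring_on S)"
    by (rule comm_monoidI) (auto simp: ring_on_def mult_mem algebra_simps)
qed (auto simp: ring_on_def algebra_simps)

lemma ideal_ring_on_iff:
  "ideal I (ring_on S) \<longleftrightarrow>
     I \<subseteq> S \<and> 0 \<in> I \<and> (\<forall>a\<in>I. \<forall>b\<in>I. a + b \<in> I) \<and> (\<forall>a\<in>I. \<forall>x\<in>S. x * a \<in> I)"
  (is "?L \<longleftrightarrow> ?R")
proof
  assume ?L
  then interpret ideal I "ring_on S" .
  show ?R
    using a_subset additive_subgroup.zero_closed[OF is_additive_subgroup]
      additive_subgroup.a_closed[OF is_additive_subgroup] I_l_closed
    by (auto simp: ring_on_def)
next
  assume R: ?R
  interpret cring "ring_on S" by (rule cring_ring_on)
  have neg: "- a \<in> I" if "a \<in> I" for a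
  proof -
    have "(- 1) * a \<in> I" using R that uminus_mem[OF one_mem] by blast
    then show ?thesis by simp
  qed
  show ?L
  proof (rule idealI)
    show "ring (ring_on S)" by (rule ring_axioms)
    show "subgroup I (add_monoid (ring_on S))"
    proof (rule add.subgroupI)
      show "I \<subseteq> carrier (ring_on S)" "I \<noteq> {}" using R by (auto simp: ring_on_def)
    next
      fix a assume a: "a \<in> I"
      then have aS: "a \<in> carrier (ring_on S)" using R by (auto simp: ring_on_def)
      have "\<ominus>\<^bsub>ring_on S\<^esub> a = - a"
        by (rule minus_equality) (use a R neg in \<open>auto simp: ring_on_def\<close>)
      then show "\<ominus>\<^bsub>ring_on S\<^esub> a \<in> I" using neg[OF a] by simp
    next
      fix a b assume "a \<in> I" "b \<in> I"
      then show "a \<oplus>\<^bsub>ring_on S\<^esub> b \<in> I" using R by (auto simp: ring_on_def)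
    qed
  qed (use R in \<open>auto simp: ring_on_def mult.commute\<close>)
qed

lemma principal_ideal_ring_on: "PIdl\<^bsub>ring_on S\<^esub> a = {x * a | x. x \<in> S}"
  unfolding cgenideal_def by (auto simp: ring_on_def)

end

lemma unital_subring_UNIV: "unital_subring UNIV"
  by unfold_locales auto

lemmas ideal_UNIV_iff = unital_subring.ideal_ring_on_iff[OF unital_subring_UNIV, simplified]

definition polys_over :: "'a::comm_ring_1 set \<Rightarrow> 'a poly set" where
  "polys_over S = {f. \<forall>i. coeff f i \<in> S}"

context unital_subring
begin

lemma coeff_polys_over: "f \<in> polys_over S \<Longrightarrow> coeff f i \<in> S"
  by (auto simp: polys_over_def)

lemma const_polys_over [simp]: "[:c:] \<in> polys_over S \<longleftrightarrow> c \<in> S"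
  by (auto simp: polys_over_def coeff_pCons split: nat.splits)

lemma pCons_polys_over: "c \<in> S \<Longrightarrow> f \<in> polys_over S \<Longrightarrow> pCons c f \<in> polys_over S"
  by (auto simp: polys_over_def coeff_pCons split: nat.splits)

lemma monom_polys_over: "c \<in> S \<Longrightarrow> monom c k \<in> polys_over S"
  by (auto simp: polys_over_def)

lemma unital_subring_polys_over: "unital_subring (polys_over S)"
proof
  show "1 \<in> polys_over S" unfolding one_pCons by (simp add: one_mem)
qed (auto simp: polys_over_def coeff_mult intro!: diff_mem sum_mem mult_mem)

interpretation polys: unital_subring "polys_over S"
  by (rule unital_subring_polys_over)

lemma smult_polys_over: "c \<in> S \<Longrightarrow> f \<in> polys_over S \<Longrightarrow> smult c f \<in> polys_over S"
  by (auto simp: polys_over_def mult_mem)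

lemma poly_mem: "f \<in> polys_over S \<Longrightarrow> x \<in> S \<Longrightarrow> poly f x \<in> S"
  unfolding poly_altdef by (auto simp: polys_over_def intro!: sum_mem mult_mem power_mem)

lemma pcompose_polys_over:
  "f \<in> polys_over S \<Longrightarrow> g \<in> polys_over S \<Longrightarrow> pcompose f g \<in> polys_over S"
proof (induction f)
  case (pCons c f)
  from pCons.prems(1) have "c \<in> S" "f \<in> polys_over S"
    by (auto simp: polys_over_def coeff_pCons split: nat.splits dest: spec[of _ 0] spec[of _ "Suc _"])
  then show ?case using pCons
    by (auto simp: pcompose_pCons intro!: polys.add_mem polys.mult_mem)
qed simp

end

section \<open>Polynomials evaluated at a matrix\<close>

lemma matrices_over_iff:
  "A \<in> matrices_over n S \<longleftrightarrow> A \<in> carrier_mat n n \<and> (\<forall>i<n. \<forall>j<n. A $$ (i, j) \<in> S)"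
  unfolding matrices_over_def elements_mat_def by (auto simp: UN_subset_iff image_subset_iff)

lemma eval_mat_carrier [simp]: "A \<in> carrier_mat n n \<Longrightarrow> eval_mat f A \<in> carrier_mat n n"
  unfolding eval_mat_def by auto

lemma dim_eval_mat [simp]:
  "dim_row (eval_mat f A) = dim_row A" "dim_col (eval_mat f A) = dim_row A"
  by (auto simp: eval_mat_def)

lemma eval_mat_index:
  assumes "A \<in> carrier_mat n n" "i < n" "j < n" "degree f \<le> N"
  shows "eval_mat f A $$ (i, j) = (\<Sum>k\<le>N. coeff f k * (A ^\<^sub>m k) $$ (i, j))"
proof -
  have "(\<Sum>k\<le>degree f. coeff f k * (A ^\<^sub>m k) $$ (i, j)) = (\<Sum>k\<le>N. coeff f k * (A ^\<^sub>m k) $$ (i, j))"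
    by (rule sum.mono_neutral_left) (use assms(4) in \<open>auto simp: coeff_eq_0\<close>)
  then show ?thesis using assms by (auto simp: eval_mat_def)
qed

lemma eval_mat_add:
  assumes "A \<in> carrier_mat n n"
  shows "eval_mat (f + g) A = eval_mat f A + eval_mat g A"
proof (rule eq_matI)
  fix i j assume "i < dim_row (eval_mat f A + eval_mat g A)" "j < dim_col (eval_mat f A + eval_mat g A)"
  then have ij: "i < n" "j < n" using assms by (auto simp: eval_mat_def)
  let ?N = "max (degree f) (degree g)"
  have "eval_mat (f + g) A $$ (i, j) = (\<Sum>k\<le>?N. coeff (f + g) k * (A ^\<^sub>m k) $$ (i, j))"
    by (rule eval_mat_index[OF assms ij]) (rule degree_add_le_max)
  also have "\<dots> = eval_mat f A $$ (i, j) + eval_mat g A $$ (i, j)"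
    by (simp add: eval_mat_index[OF assms ij, of _ ?N] sum.distrib distrib_right)
  finally show "eval_mat (f + g) A $$ (i, j) = (eval_mat f A + eval_mat g A) $$ (i, j)"
    using assms ij by (simp add: eval_mat_def)
qed (use assms in \<open>auto simp: eval_mat_def\<close>)

lemma eval_mat_smult:
  assumes "A \<in> carrier_mat n n"
  shows "eval_mat (smult c f) A = c \<cdot>\<^sub>m eval_mat f A"
proof (rule eq_matI)
  fix i j assume "i < dim_row (c \<cdot>\<^sub>m eval_mat f A)" "j < dim_col (c \<cdot>\<^sub>m eval_mat f A)"
  then have ij: "i < n" "j < n" using assms by auto
  then show "eval_mat (smult c f) A $$ (i, j) = (c \<cdot>\<^sub>m eval_mat f A) $$ (i, j)"
    using assms eval_mat_index[OF assms ij degree_smult_le] eval_mat_index[OF assms ij order.refl]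
    by (simp add: eval_mat_def sum_distrib_left mult.assoc)
qed (use assms in \<open>auto simp: eval_mat_def\<close>)

lemma eval_mat_pCons:
  assumes A: "A \<in> carrier_mat n n"
  shows "eval_mat (pCons c f) A = c \<cdot>\<^sub>m 1\<^sub>m n + eval_mat f A * A"
proof (rule eq_matI)
  fix i j assume "i < dim_row (c \<cdot>\<^sub>m 1\<^sub>m n + eval_mat f A * A)" "j < dim_col (c \<cdot>\<^sub>m 1\<^sub>m n + eval_mat f A * A)"
  then have ij: "i < n" "j < n" using A by auto
  have pw: "A ^\<^sub>m k \<in> carrier_mat n n" for k using A by (rule pow_carrier_mat)
  have "eval_mat (pCons c f) A $$ (i, j)
      = (\<Sum>k\<le>Suc (degree f). coeff (pCons c f) k * (A ^\<^sub>m k) $$ (i, j))"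
    by (rule eval_mat_index[OF A ij]) (rule degree_pCons_le)
  also have "\<dots> = c * (1\<^sub>m n) $$ (i, j) + (\<Sum>k\<le>degree f. coeff f k * (A ^\<^sub>m k * A) $$ (i, j))"
    using A by (subst sum.atMost_Suc_shift) simp
  also have "(\<Sum>k\<le>degree f. coeff f k * (A ^\<^sub>m k * A) $$ (i, j))
      = (\<Sum>k\<le>degree f. \<Sum>l<n. coeff f k * (A ^\<^sub>m k) $$ (i, l) * A $$ (l, j))"
    using A pw ij
    by (auto simp: scalar_prod_def sum_distrib_left mult.assoc lessThan_atLeast0 intro!: sum.cong)
  also have "\<dots> = (\<Sum>l<n. eval_mat f A $$ (i, l) * A $$ (l, j))"
    using A ij by (subst sum.swap) (auto simp: eval_mat_def sum_distrib_right intro!: sum.cong)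
  also have "\<dots> = (eval_mat f A * A) $$ (i, j)"
    using A ij eval_mat_carrier[OF A, of f]
    by (auto simp: scalar_prod_def lessThan_atLeast0 intro!: sum.cong)
  finally show "eval_mat (pCons c f) A $$ (i, j) = (c \<cdot>\<^sub>m 1\<^sub>m n + eval_mat f A * A) $$ (i, j)"
    using ij A eval_mat_carrier[OF A, of f] by simp
qed (use A in \<open>auto simp: eval_mat_def\<close>)

lemma eval_mat_0: "A \<in> carrier_mat n n \<Longrightarrow> eval_mat 0 A = 0\<^sub>m n n"
  by (auto simp: eval_mat_def)

lemma eval_mat_const: "A \<in> carrier_mat n n \<Longrightarrow> eval_mat [:c:] A = c \<cdot>\<^sub>m 1\<^sub>m n"
  by (simp add: eval_mat_pCons eval_mat_0 left_mult_zero_mat)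

lemma eval_mat_mult:
  assumes A: "A \<in> carrier_mat n n"
  shows "eval_mat (f * g) A = eval_mat f A * eval_mat g A"
proof (induction g)
  case 0
  show ?case using right_mult_zero_mat[OF eval_mat_carrier[OF A, of f]] by (simp add: eval_mat_0[OF A])
next
  case (pCons c g)
  note E = eval_mat_carrier[OF A]
  have [simp]: "0 \<cdot>\<^sub>m 1\<^sub>m n + B = B" if "B \<in> carrier_mat n n" for B :: "'a mat"
    using that by (intro eq_matI) auto
  have "eval_mat (f * pCons c g) A = eval_mat (smult c f) A + eval_mat (pCons 0 (f * g)) A"
    by (simp add: mult_pCons_right eval_mat_add[OF A])
  also have "\<dots> = c \<cdot>\<^sub>m eval_mat f A + (eval_mat f A * eval_mat g A) * A"
    using A by (simp add: eval_mat_pCons[OF A] eval_mat_smult[OF A] pCons.IH mult_carrier_mat[of _ n n])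
  also have "(eval_mat f A * eval_mat g A) * A = eval_mat f A * (eval_mat g A * A)"
    by (rule assoc_mult_mat[OF E E A])
  also have "c \<cdot>\<^sub>m eval_mat f A = eval_mat f A * (c \<cdot>\<^sub>m 1\<^sub>m n)"
    using mult_smult_distrib[OF E[of f] one_carrier_mat, of c] right_mult_one_mat[OF E[of f]] by simp
  also have "\<dots> + eval_mat f A * (eval_mat g A * A) = eval_mat f A * eval_mat (pCons c g) A"
    unfolding eval_mat_pCons[OF A]
    by (rule mult_add_distrib_mat[symmetric, of _ n n _ n]) (use E A in auto)
  finally show ?case .
qed

lemma eval_mat_sum_index:
  assumes "A \<in> carrier_mat n n" "i < n" "j < n"
  shows "eval_mat (\<Sum>x\<in>X. f x) A $$ (i, j) = (\<Sum>x\<in>X. eval_mat (f x) A $$ (i, j))"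
  using assms
  by (induction X rule: infinite_finite_induct) (auto simp: eval_mat_0 eval_mat_add)

lemma eval_mat_mult_index:
  assumes "A \<in> carrier_mat n n" "i < n" "j < n"
  shows "eval_mat (f * g) A $$ (i, j) = (\<Sum>k<n. eval_mat f A $$ (i, k) * eval_mat g A $$ (k, j))"
proof -
  have "eval_mat (f * g) A $$ (i, j) = row (eval_mat f A) i \<bullet> col (eval_mat g A) j"
    unfolding eval_mat_mult[OF assms(1)]
    by (rule index_mult_mat(1))
       (use assms in auto)
  then show ?thesis
    using assms by (auto simp: scalar_prod_def lessThan_atLeast0 intro!: sum.cong)
qed

text \<open>
  Multiply the relations \<open>\<Sum>i. M i j (A) e i = 0\<close>, where \<open>M\<close> is the characteristic matrix \<open>x - A\<close> and
  polynomials act on vectors by evaluation at \<open>A\<close>, by the adjugate of \<open>M\<close>: the product is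
  \<open>det M = \<chi>\<close> times the identity, so \<open>\<chi>(A)\<close> annihilates every unit vector.
\<close>

lemma cayley_hamilton:
  fixes A :: "'a::comm_ring_1 mat"
  assumes A: "A \<in> carrier_mat n n"
  shows "eval_mat (char_poly A) A = 0\<^sub>m n n"
proof (rule eq_matI)
  fix r l assume "r < dim_row (0\<^sub>m n n :: 'a mat)" "l < dim_col (0\<^sub>m n n :: 'a mat)"
  then have rl: "r < n" "l < n" by auto
  define M where "M = char_poly_matrix A"
  define N where "N = adj_mat M"
  have M: "M \<in> carrier_mat n n" using A by (simp add: M_def)
  have N: "N \<in> carrier_mat n n" using adj_mat(1)[OF M] by (simp add: N_def)
  have MN: "(\<Sum>j<n. N $$ (j, l) * M $$ (i, j)) = (if i = l then char_poly A else 0)" if "i < n" for i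
  proof -
    have "(M * N) $$ (i, l) = (\<Sum>j<n. M $$ (i, j) * N $$ (j, l))"
      using M N that rl by (auto simp: scalar_prod_def lessThan_atLeast0 intro!: sum.cong)
    moreover have "M * N = char_poly A \<cdot>\<^sub>m 1\<^sub>m n"
      unfolding N_def using adj_mat(2)[OF M] by (simp add: char_poly_def M_def)
    ultimately show ?thesis using that rl by (auto simp: mult.commute)
  qed
  have MA: "(\<Sum>i<n. eval_mat (M $$ (i, j)) A $$ (s, i)) = 0" if "j < n" "s < n" for j s
  proof -
    have "eval_mat (M $$ (i, j)) A $$ (s, i)
        = (if i = j then A $$ (s, j) else 0) - (if i = s then A $$ (s, j) else 0)" if "i < n" for i
    proof -
      have "M $$ (i, j) = (if i = j then [:- A $$ (i, j), 1:] else [:- A $$ (i, j):])"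
        using A \<open>i < n\<close> \<open>j < n\<close> by (auto simp: M_def char_poly_matrix_def)
      then show ?thesis
        using A \<open>i < n\<close> \<open>j < n\<close> \<open>s < n\<close>
        by (auto simp: eval_mat_pCons eval_mat_0 left_mult_one_mat[OF A])
    qed
    then have "(\<Sum>i<n. eval_mat (M $$ (i, j)) A $$ (s, i))
      = (\<Sum>i<n. (if i = j then A $$ (s, j) else 0) - (if i = s then A $$ (s, j) else 0))"
      by (intro sum.cong) auto
    also have "\<dots> = 0" using that by (simp add: sum_subtractf)
    finally show ?thesis .
  qed
  have "eval_mat (char_poly A) A $$ (r, l)
      = (\<Sum>i<n. if i = l then eval_mat (char_poly A) A $$ (r, i) else 0)"
    using rl by simp
  also have "\<dots> = (\<Sum>i<n. eval_mat (\<Sum>j<n. N $$ (j, l) * M $$ (i, j)) A $$ (r, i))"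
    using rl A by (intro sum.cong) (auto simp: MN eval_mat_0)
  also have "\<dots> = (\<Sum>i<n. \<Sum>j<n. \<Sum>s<n.
      eval_mat (N $$ (j, l)) A $$ (r, s) * eval_mat (M $$ (i, j)) A $$ (s, i))"
    using rl A by (intro sum.cong) (auto simp: eval_mat_sum_index eval_mat_mult_index)
  also have "\<dots> = (\<Sum>j<n. \<Sum>i<n. \<Sum>s<n.
      eval_mat (N $$ (j, l)) A $$ (r, s) * eval_mat (M $$ (i, j)) A $$ (s, i))"
    by (rule sum.swap)
  also have "\<dots> = (\<Sum>j<n. \<Sum>s<n. eval_mat (N $$ (j, l)) A $$ (r, s) *
      (\<Sum>i<n. eval_mat (M $$ (i, j)) A $$ (s, i)))"
    unfolding sum_distrib_left by (rule sum.cong[OF refl], rule sum.swap)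
  also have "\<dots> = 0" by (simp add: MA)
  finally show "eval_mat (char_poly A) A $$ (r, l) = 0\<^sub>m n n $$ (r, l)" using rl by simp
qed (use A in \<open>auto simp: eval_mat_def\<close>)

lemma (in unital_subring) char_poly_polys_over:
  assumes A: "A \<in> matrices_over n S"
  shows "char_poly A \<in> polys_over S"
proof -
  interpret polys: unital_subring "polys_over S" by (rule unital_subring_polys_over)
  have A': "A \<in> carrier_mat n n" "\<And>i j. i < n \<Longrightarrow> j < n \<Longrightarrow> A $$ (i, j) \<in> S"
    using A by (auto simp: matrices_over_iff)
  have ent: "char_poly_matrix A $$ (i, j) \<in> polys_over S" if "i < n" "j < n" for i j
    using that A' by (auto simp: char_poly_matrix_def intro!: pCons_polys_over uminus_mem)
  have sgn: "signof p \<in> polys_over S" for p :: "nat \<Rightarrow> nat"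
    by (auto simp: sign_def intro!: polys.uminus_mem)
  show ?thesis
    unfolding char_poly_def det_def'[OF char_poly_matrix_closed[OF A'(1)]]
    by (intro polys.sum_mem polys.mult_mem polys.prod_mem sgn ent)
       (auto simp: permutes_in_image)
qed

lemma (in unital_subring) unital_subring_integral_at:
  assumes A: "A \<in> matrices_over n S"
  shows "unital_subring {f. eval_mat f A \<in> matrices_over n S}"
proof
  note A' = A[unfolded matrices_over_iff, THEN conjunct1]
  show "1 \<in> {f. eval_mat f A \<in> matrices_over n S}"
    unfolding one_pCons using A' by (auto simp: eval_mat_const matrices_over_iff)
  fix f g assume fg: "f \<in> {f. eval_mat f A \<in> matrices_over n S}" "g \<in> {f. eval_mat f A \<in> matrices_over n S}"
  then show "f * g \<in> {f. eval_mat f A \<in> matrices_over n S}"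
    using A' by (auto simp: matrices_over_iff eval_mat_mult_index intro!: sum_mem mult_mem)
  have "f - g = f + smult (- 1) g" by simp
  then have "eval_mat (f - g) A = eval_mat f A + (- 1) \<cdot>\<^sub>m eval_mat g A"
    using A' by (simp only: eval_mat_add eval_mat_smult)
  then show "f - g \<in> {f. eval_mat f A \<in> matrices_over n S}"
    using fg A' by (auto simp: matrices_over_iff intro!: diff_mem)
qed

lemma (in unital_subring) polys_over_integral_at:
  assumes A: "A \<in> matrices_over n S" and f: "f \<in> polys_over S"
  shows "eval_mat f A \<in> matrices_over n S"
proof -
  note A' = A[unfolded matrices_over_iff]
  have pw: "A ^\<^sub>m k \<in> matrices_over n S" for k
  proof (induction k)
    case 0
    then show ?case using A' by (auto simp: matrices_over_iff)
  next
    case (Suc k)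
    then show ?case using A'
      by (auto simp: matrices_over_iff scalar_prod_def intro!: sum_mem mult_mem)
  qed
  then show ?thesis
    using A' f by (auto simp: matrices_over_iff eval_mat_index[OF _ _ _ order.refl]
        intro!: sum_mem mult_mem coeff_polys_over)
qed

section \<open>Polynomials over a field\<close>

lemma exists_irreducible_monic_divisor:
  fixes d :: "'f::field poly"
  assumes "degree d \<noteq> 0"
  shows "\<exists>p. irreducible p \<and> lead_coeff p = 1 \<and> p dvd d"
proof -
  obtain p where p: "p dvd d \<and> degree p \<noteq> 0"
    and min: "\<And>p'. p' dvd d \<and> degree p' \<noteq> 0 \<Longrightarrow> degree p \<le> degree p'"
    using ex_has_least_nat[of "\<lambda>p. p dvd d \<and> degree p \<noteq> 0" d degree] assms by auto
  then have p0: "p \<noteq> 0" by auto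
  have irr: "irreducible p"
  proof (rule Factorial_Ring.irreducibleI)
    show "p \<noteq> 0" by (rule p0)
    show "\<not> p dvd 1" using p is_unit_iff_degree[OF p0] by simp
    fix a b assume ab: "p = a * b"
    then have nz: "a \<noteq> 0" "b \<noteq> 0" using p0 by auto
    have "degree p = degree a + degree b" using ab nz by (simp add: degree_mult_eq)
    moreover have "a dvd d" "b dvd d" using p ab by (auto intro: dvd_mult_left dvd_mult_right)
    ultimately have "degree a = 0 \<or> degree b = 0" using min[of a] min[of b] by fastforce
    then show "a dvd 1 \<or> b dvd 1" using is_unit_iff_degree[OF nz(1)] is_unit_iff_degree[OF nz(2)] by simp
  qed
  let ?c = "inverse (lead_coeff p)"
  have c: "?c \<noteq> 0" using p0 by simp
  have "irreducible (smult ?c p)"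
  proof (rule Factorial_Ring.irreducibleI)
    show "smult ?c p \<noteq> 0" using p0 by simp
    show "\<not> smult ?c p dvd 1" using p p0 by (simp add: is_unit_iff_degree)
    fix a b assume "smult ?c p = a * b"
    then have "smult (lead_coeff p) (smult ?c p) = smult (lead_coeff p) a * b" by simp
    then have "p = smult (lead_coeff p) a * b" using p0 by simp
    then have "smult (lead_coeff p) a dvd 1 \<or> b dvd 1" by (rule Factorial_Ring.irreducibleD[OF irr])
    then show "a dvd 1 \<or> b dvd 1" by (auto dest: smult_dvd_cancel)
  qed
  moreover have "lead_coeff (smult ?c p) = 1" using p0 by simp
  moreover have "smult ?c p dvd d" using p c by (simp add: smult_dvd_iff)
  ultimately show ?thesis by blast
qed

text \<open>
  A local-to-global principle: an ideal that lies in none of the ideals \<open>(p)\<close> with \<open>p\<close> monic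
  irreducible is everything, as its generator of least degree has no irreducible factor.
\<close>

lemma poly_ideal_contains_one:
  fixes I :: "'f::field poly set"
  assumes diff: "\<And>x y. x \<in> I \<Longrightarrow> y \<in> I \<Longrightarrow> x - y \<in> I"
    and mult: "\<And>u x. x \<in> I \<Longrightarrow> u * x \<in> I"
    and ex: "\<And>p. irreducible p \<Longrightarrow> lead_coeff p = 1 \<Longrightarrow> \<exists>x\<in>I. \<not> p dvd x"
  shows "1 \<in> I"
proof -
  have "degree [:0, 1 :: 'f:] \<noteq> 0" by simp
  then obtain p0 :: "'f poly" where p0: "irreducible p0" "lead_coeff p0 = 1"
    using exists_irreducible_monic_divisor by blast
  obtain x0 where "x0 \<in> I" "x0 \<noteq> 0" using ex[OF p0] by force
  then obtain d where d: "d \<in> I \<and> d \<noteq> 0" and min: "\<And>x. x \<in> I \<and> x \<noteq> 0 \<Longrightarrow> degree d \<le> degree x"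
    using ex_has_least_nat[of "\<lambda>x. x \<in> I \<and> x \<noteq> 0" x0 degree] by auto
  have dvd: "d dvd x" if x: "x \<in> I" for x
  proof (rule ccontr)
    assume "\<not> d dvd x"
    then have m0: "x mod d \<noteq> 0" by (simp add: dvd_eq_mod_eq_0)
    have "x mod d = x - (x div d) * d" by (simp add: minus_div_mult_eq_mod)
    then have "x mod d \<in> I" using diff[OF x mult] d by metis
    moreover have "degree (x mod d) < degree d" using degree_mod_less[of d x] d m0 by auto
    ultimately show False using min[of "x mod d"] m0 by auto
  qed
  have "degree d = 0"
  proof (rule ccontr)
    assume "degree d \<noteq> 0"
    then obtain p where p: "irreducible p" "lead_coeff p = 1" "p dvd d"
      using exists_irreducible_monic_divisor by blast
    obtain x where "x \<in> I" "\<not> p dvd x" using ex[OF p(1,2)] by blast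
    then show False using dvd[of x] p(3) dvd_trans by blast
  qed
  then have "d dvd 1" using d is_unit_iff_degree by blast
  then obtain e where "1 = d * e" unfolding dvd_def by blast
  then show ?thesis using mult[of d e] d by (simp add: mult.commute)
qed

lemma factor_out_power:
  fixes p f :: "'f::field poly"
  assumes "p \<noteq> 0" "degree f \<noteq> 0"
  obtains k u where "p = f ^ k * u" "\<not> f dvd u"
proof -
  have f0: "f \<noteq> 0" using assms(2) by auto
  have bound: "k \<le> degree p" if "f ^ k dvd p" for k
  proof -
    have "k * degree f \<le> degree p" using dvd_imp_degree_le[OF that assms(1)] f0
      by (simp add: degree_power_eq mult.commute)
    then show ?thesis using assms(2) by (cases "degree f") (auto simp: algebra_simps)
  qed
  define k where "k = (GREATEST k. f ^ k dvd p)"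
  have k: "f ^ k dvd p" unfolding k_def
    by (rule GreatestI_nat[of _ 0 "degree p"]) (use bound in auto)
  have max: "j \<le> k" if "f ^ j dvd p" for j unfolding k_def
    by (rule Greatest_le_nat[of _ _ "degree p"]) (use bound that in auto)
  from k obtain u where u: "p = f ^ k * u" unfolding dvd_def by blast
  have "\<not> f dvd u"
  proof
    assume "f dvd u"
    then have "f ^ Suc k dvd p" unfolding u by (simp add: mult_dvd_mono mult.commute)
    then show False using max[of "Suc k"] by simp
  qed
  then show thesis using that u by blast
qed

section \<open>Reduction modulo a uniformizer\<close>

text \<open>
  The last condition says that the kernel of \<open>res\<close> is the principal ideal \<open>\<pi> V\<close>; this is all
  that the computations with \<open>F\<close> use of the discrete valuation ring \<open>V\<close>.
\<close>

locale residue_ring = unital_subring V for V :: "'k::field set" +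
  fixes res :: "'k \<Rightarrow> 'f::{field,finite}" and \<pi> :: 'k
  assumes res_1 [simp]: "res 1 = 1"
    and res_add: "x \<in> V \<Longrightarrow> y \<in> V \<Longrightarrow> res (x + y) = res x + res y"
    and res_mult: "x \<in> V \<Longrightarrow> y \<in> V \<Longrightarrow> res (x * y) = res x * res y"
    and uniformizer_mem [simp]: "\<pi> \<in> V"
    and uniformizer_nonzero [simp]: "\<pi> \<noteq> 0"
    and res_eq_0_iff: "x \<in> V \<Longrightarrow> res x = 0 \<longleftrightarrow> (\<exists>v\<in>V. x = \<pi> * v)"
begin

interpretation polys: unital_subring "polys_over V"
  by (rule unital_subring_polys_over)

lemma res_0 [simp]: "res 0 = 0"
  using res_add[OF zero_mem zero_mem] by (metis add.right_neutral add_left_cancel)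

lemma res_uniformizer [simp]: "res \<pi> = 0"
  using res_eq_0_iff[of \<pi>] by (auto intro!: bexI[of _ 1])

lemma res_uminus: "x \<in> V \<Longrightarrow> res (- x) = - res x"
  using res_add[of x "- x"] uminus_mem[of x] by (simp add: eq_neg_iff_add_eq_0 add.commute)

lemma res_diff: "x \<in> V \<Longrightarrow> y \<in> V \<Longrightarrow> res (x - y) = res x - res y"
  using res_add[of x "- y"] res_uminus[of y] uminus_mem[of y] by simp

lemma res_sum: "(\<And>i. i \<in> I \<Longrightarrow> f i \<in> V) \<Longrightarrow> res (sum f I) = (\<Sum>i\<in>I. res (f i))"
  by (induction I rule: infinite_finite_induct) (auto simp: res_add sum_mem)

abbreviation red :: "'k poly \<Rightarrow> 'f poly" where
  "red f \<equiv> map_poly res f"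

lemma coeff_red: "coeff (red f) i = res (coeff f i)"
  by (simp add: coeff_map_poly)

lemma red_diff: "f \<in> polys_over V \<Longrightarrow> g \<in> polys_over V \<Longrightarrow> red (f - g) = red f - red g"
  by (intro poly_eqI) (simp add: coeff_red res_diff coeff_polys_over)

lemma red_add: "f \<in> polys_over V \<Longrightarrow> g \<in> polys_over V \<Longrightarrow> red (f + g) = red f + red g"
  by (intro poly_eqI) (simp add: coeff_red res_add coeff_polys_over)

lemma red_mult: "f \<in> polys_over V \<Longrightarrow> g \<in> polys_over V \<Longrightarrow> red (f * g) = red f * red g"
  by (intro poly_eqI)
     (simp add: coeff_red coeff_mult res_sum res_mult mult_mem coeff_polys_over)

lemma red_power: "f \<in> polys_over V \<Longrightarrow> red (f ^ k) = red f ^ k"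
  by (induction k) (auto simp: red_mult polys.power_mem)

lemma red_prod: "(\<And>i. i \<in> I \<Longrightarrow> f i \<in> polys_over V) \<Longrightarrow> red (prod f I) = (\<Prod>i\<in>I. red (f i))"
  by (induction I rule: infinite_finite_induct) (auto simp: red_mult polys.prod_mem)

lemma red_pCons [simp]: "red (pCons a f) = pCons (res a) (red f)"
  by (intro poly_eqI) (simp add: coeff_red coeff_pCons split: nat.split)

lemma res_poly: "f \<in> polys_over V \<Longrightarrow> x \<in> V \<Longrightarrow> res (poly f x) = poly (red f) (res x)"
proof (induction f)
  case (pCons a f)
  from pCons.prems(1) have "a \<in> V" "f \<in> polys_over V"
    by (auto simp: polys_over_def coeff_pCons split: nat.splits dest: spec[of _ 0] spec[of _ "Suc _"])
  then show ?case using pCons by (simp add: res_add res_mult poly_mem mult_mem)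
qed simp

lemma red_eq_0_imp:
  assumes f: "f \<in> polys_over V" and "red f = 0"
  shows "\<exists>g\<in>polys_over V. f = [:\<pi>:] * g"
proof
  show "f = [:\<pi>:] * smult (1 / \<pi>) f" by simp
  have "coeff f i / \<pi> \<in> V" for i
  proof -
    have "res (coeff f i) = 0" using assms(2) coeff_red[of f i] by simp
    then obtain v where "v \<in> V" "coeff f i = \<pi> * v"
      using res_eq_0_iff[OF coeff_polys_over[OF f]] by blast
    then show ?thesis by simp
  qed
  then show "smult (1 / \<pi>) f \<in> polys_over V" by (simp add: polys_over_def)
qed

lemma red_eq_imp:
  assumes "f \<in> polys_over V" "g \<in> polys_over V" "red f = red g"
  shows "\<exists>h\<in>polys_over V. f = g + [:\<pi>:] * h"
proof -
  obtain h where "h \<in> polys_over V" "f - g = [:\<pi>:] * h"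
    using red_eq_0_imp[of "f - g"] assms polys.diff_mem red_diff by auto
  then show ?thesis by (intro bexI[of _ h]) (auto simp: algebra_simps)
qed

lemma res_eq_imp:
  assumes "x \<in> V" "y \<in> V" "res x = res y"
  shows "\<exists>z\<in>V. x = y + \<pi> * z"
proof -
  obtain z where "z \<in> V" "x - y = \<pi> * z"
    using res_eq_0_iff[of "x - y"] assms diff_mem res_diff by auto
  then show ?thesis by (intro bexI[of _ z]) (auto simp: algebra_simps)
qed

end

lemma (in unital_subring) synthetic_div_polys_over:
  assumes "c \<in> S" shows "f \<in> polys_over S \<Longrightarrow> synthetic_div f c \<in> polys_over S"
proof (induction f)
  case (pCons a f)
  from pCons.prems(1) have "f \<in> polys_over S"
    by (auto simp: polys_over_def coeff_pCons split: nat.splits dest: spec[of _ "Suc _"])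
  then show ?case using pCons by (auto intro!: pCons_polys_over poly_mem assms)
qed (simp add: polys_over_def)

lemma (in unital_subring) divide_linear_polys_over:
  assumes "c \<in> S" "f \<in> polys_over S"
  shows "\<exists>g\<in>polys_over S. f = [:- c, 1:] * g + [:poly f c:]"
  using synthetic_div_polys_over[OF assms] synthetic_div_correct'[of c f]
  by (intro bexI[of _ "synthetic_div f c"]) auto

section \<open>The polynomial F\<close>

locale residue_lifts = residue_ring V res \<pi>
  for V :: "'k::field set" and res :: "'k \<Rightarrow> 'f::{field,finite}" and \<pi> +
  fixes rep :: "'f \<Rightarrow> 'k" and prep :: "'f poly \<Rightarrow> 'k poly" and n :: nat
  assumes rep: "residue_lift V res rep" and prep: "residue_poly_lift V res prep"
    and n_ge_2: "2 \<le> n"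
begin

interpretation polys: unital_subring "polys_over V"
  by (rule unital_subring_polys_over)

lemma card_residue_field_ge_2: "2 \<le> CARD('f)"
proof -
  have "card {0, 1 :: 'f} \<le> CARD('f)" by (intro card_mono) auto
  then show ?thesis by simp
qed

lemma card_nonzero: "card (UNIV - {0 :: 'f}) = CARD('f) - 1"
  by (simp add: card_Diff_singleton)

lemma rep_mem [simp]: "rep a \<in> V" and res_rep [simp]: "res (rep a) = a"
  using rep by (auto simp: residue_lift_def)

lemma prep_mem [simp]: "prep f \<in> polys_over V" and red_prep [simp]: "red (prep f) = f"
  using prep by (auto simp: residue_poly_lift_def polys_over_def coeff_red intro!: poly_eqI)

definition shift :: "'f \<Rightarrow> 'k poly" where
  "shift b = [:- rep b, 1:]"

text \<open>
  This is \<open>h(x - b)\<close>, as \<open>H_poly_eq\<close> shows.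
\<close>

definition h_at :: "'f \<Rightarrow> 'k poly" where
  "h_at b = shift b ^ (n - 1) * (\<Prod>a\<in>UNIV - {0}. shift b ^ n + [:\<pi> * rep a:])"

lemma shift_mem [simp]: "shift b \<in> polys_over V"
  by (auto simp: shift_def intro!: pCons_polys_over uminus_mem)

lemma red_shift [simp]: "red (shift b) = [:- b, 1:]"
  by (simp add: shift_def res_uminus)

lemma factor_mem: "shift b ^ n + [:\<pi> * rep a:] \<in> polys_over V"
  by (intro polys.add_mem polys.power_mem) (auto intro!: mult_mem)

lemma red_factor: "red (shift b ^ n + [:\<pi> * rep a:]) = [:- b, 1:] ^ n"
  by (subst red_add) (auto simp: red_power polys.power_mem res_mult mult_mem)

lemma h_at_mem: "h_at b \<in> polys_over V"
  unfolding h_at_def by (intro polys.mult_mem polys.power_mem polys.prod_mem factor_mem) auto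

lemma H_poly_eq: "H_poly n \<pi> rep = (\<Prod>b\<in>UNIV. h_at b)"
proof -
  have "pcompose (monom 1 k) (shift b) = shift b ^ k" for k b
    by (induction k) (simp_all add: monom_0 monom_Suc pcompose_pCons pcompose_1 one_pCons[symmetric])
  then have "pcompose (h_poly n \<pi> rep) (shift b) = h_at b" for b
    unfolding h_poly_def h_at_def
    by (simp add: pcompose_mult pcompose_prod pcompose_add pcompose_const)
  then show ?thesis by (simp add: H_poly_def shift_def)
qed

definition G :: "'k poly" where
  "G = (\<Prod>b\<in>UNIV. h_at b) * theta_poly n prep ^ CARD('f)"

lemma F_poly_eq: "F_poly n \<pi> rep prep = smult (1 / \<pi> ^ CARD('f)) G"
  by (simp add: F_poly_def G_def H_poly_eq)

text \<open>
  The part of \<open>G\<close> that is invertible at \<open>b\<close> modulo \<open>\<pi>\<close>: only \<open>h_at b\<close> is small near \<open>b\<close>.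
\<close>

definition cofactor_at :: "'f \<Rightarrow> 'k poly" where
  "cofactor_at b = (\<Prod>b'\<in>UNIV - {b}. h_at b') * theta_poly n prep ^ CARD('f)"

lemma theta_mem: "theta_poly n prep \<in> polys_over V"
  unfolding theta_poly_def by (intro polys.prod_mem polys.power_mem) simp

lemma cofactor_at_mem: "cofactor_at b \<in> polys_over V"
  unfolding cofactor_at_def by (intro polys.mult_mem polys.prod_mem polys.power_mem h_at_mem theta_mem)

lemma G_split: "G = h_at b * cofactor_at b"
  unfolding G_def cofactor_at_def by (subst prod.remove[of _ b]) (auto simp: mult.assoc)

lemma G_mem: "G \<in> polys_over V"
  unfolding G_split[of 0] by (intro polys.mult_mem h_at_mem cofactor_at_mem)

lemma finite_irred_polys: "finite (irred_polys n :: 'f poly set)"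
proof (rule finite_subset)
  show "irred_polys n \<subseteq> (\<lambda>xs. Poly xs) ` {xs :: 'f list. set xs \<subseteq> UNIV \<and> length xs \<le> Suc n}"
  proof
    fix f :: "'f poly" assume "f \<in> irred_polys n"
    then have "degree f \<le> n" by (simp add: irred_polys_def)
    then show "f \<in> (\<lambda>xs. Poly xs) ` {xs. set xs \<subseteq> UNIV \<and> length xs \<le> Suc n}"
      by (intro image_eqI[of _ _ "coeffs f"]) (simp, cases "f = 0", auto simp: length_coeffs_degree)
  qed
qed (rule finite_imageI, rule finite_lists_length_le, simp)

lemma red_theta: "red (theta_poly n prep) = (\<Prod>f\<in>irred_polys n. f ^ (n div degree f))"
  unfolding theta_poly_def by (simp add: red_prod red_power polys.power_mem)

lemma irreducible_root_degree:
  fixes f :: "'f poly"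
  assumes "irreducible f" "poly f a = 0"
  shows "degree f = 1"
proof -
  obtain g where g: "f = [:- a, 1:] * g" using assms(2) unfolding poly_eq_0_iff_dvd dvd_def by blast
  have "f \<noteq> 0" using assms(1) by auto
  then have g0: "g \<noteq> 0" using g by auto
  have "\<not> [:- a, 1:] dvd 1" by (simp add: is_unit_iff_degree)
  then have "g dvd 1" using Factorial_Ring.irreducibleD[OF assms(1) g] by blast
  then have "degree g = 0" using g0 is_unit_iff_degree by blast
  then show ?thesis unfolding g using g0 by (subst degree_mult_eq) auto
qed

lemma res_cofactor_at_nonzero: "res (poly (cofactor_at b) (rep b)) \<noteq> 0"
proof -
  have 1: "poly f b \<noteq> 0" if "f \<in> irred_polys n" for f
    using irreducible_root_degree[of f b] that by (auto simp: irred_polys_def)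
  have 2: "poly (red (h_at b')) b \<noteq> 0" if "b' \<noteq> b" for b'
    unfolding h_at_def using that
    by (simp add: red_mult red_prod red_power red_factor factor_mem polys.power_mem polys.prod_mem
        poly_prod poly_power)
  have "red (cofactor_at b) = (\<Prod>b'\<in>UNIV - {b}. red (h_at b'))
      * (\<Prod>f\<in>irred_polys n. f ^ (n div degree f)) ^ CARD('f)"
    unfolding cofactor_at_def
    by (simp add: polys.prod_mem polys.power_mem h_at_mem theta_mem red_mult red_prod red_power red_theta)
  then have "poly (red (cofactor_at b)) b \<noteq> 0"
    using finite_irred_polys 1 2 by (auto simp: poly_prod poly_power)
  then show ?thesis by (simp add: res_poly cofactor_at_mem)
qed

end

section \<open>A coefficient of F that is not integral\<close>

context residue_lifts
begin

interpretation polys: unital_subring "polys_over V"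
  by (rule unital_subring_polys_over)

text \<open>
  The \<open>q\<close> divisions by \<open>\<pi>\<close> are distributed over the factors of \<open>h(x - b)\<close>: one goes to the power
  of \<open>x - b\<close>, and one to each of the \<open>q - 1\<close> binomials.
\<close>

lemma scaled_G:
  "F_poly n \<pi> rep prep
     = [:1 / \<pi>:] * shift b ^ (n - 1) *
       (\<Prod>a\<in>UNIV - {0}. [:1 / \<pi>:] * (shift b ^ n + [:\<pi> * rep a:])) * cofactor_at b"
proof -
  have C: "CARD('f) = Suc (CARD('f) - 1)" using card_residue_field_ge_2 by simp
  have "smult (1 / \<pi> ^ CARD('f)) f = [:1 / \<pi>:] * [:1 / \<pi>:] ^ (CARD('f) - 1) * f" for f
    by (subst C) (simp only: power_Suc, simp add: poly_const_pow power_divide mult.commute)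
  then show ?thesis
    unfolding F_poly_eq G_split[of b] h_at_def prod.distrib prod_constant card_nonzero
    by (simp only: mult_ac)
qed

text \<open>
  With \<open>X\<close> for the indeterminate, \<open>(X - rep 0)^n = X^n + \<pi> M\<close>, where \<open>M\<close> has constant term
  divisible by \<open>\<pi>\<close> because \<open>rep 0\<close> is and \<open>n \<ge> 2\<close>. So modulo \<open>X^n\<close> each binomial divided by \<open>\<pi>\<close>
  becomes \<open>M + rep a\<close> with unit constant term, and \<open>F\<close> becomes \<open>X^(n-1) N / \<pi>\<close> up to an element of
  \<open>V[x]\<close>, where \<open>N\<close> has unit constant term.
\<close>

lemma F_poly_not_integral:
  assumes c: "c \<in> V" "res c \<noteq> 0"
  shows "coeff (smult c (F_poly n \<pi> rep prep)) (n - 1) \<notin> V"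
proof
  define X :: "'k poly" where "X = monom 1 1"
  have X: "X \<in> polys_over V" by (simp add: X_def monom_polys_over)
  have redX: "red X = [:0, 1:]" by (simp add: X_def monom_Suc monom_0)
  have "\<exists>M\<in>polys_over V. shift 0 ^ k = X ^ k + [:\<pi>:] * M" for k
    by (rule red_eq_imp) (auto simp: polys.power_mem X red_power redX)
  then obtain M M' where M: "M \<in> polys_over V" "shift 0 ^ n = X ^ n + [:\<pi>:] * M"
    and M': "M' \<in> polys_over V" "shift 0 ^ (n - 1) = X ^ (n - 1) + [:\<pi>:] * M'"
    by metis
  have Xk: "X ^ k = monom 1 k" for k by (simp add: X_def monom_power)
  obtain \<rho> where \<rho>: "\<rho> \<in> V" "rep 0 = \<pi> * \<rho>"
    using res_eq_0_iff[of "rep 0"] by auto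
  have "poly M 0 = \<pi> * ((- \<rho>)^2 * (- rep 0) ^ (n - 2))"
  proof -
    have "poly (shift 0 ^ n) 0 = \<pi> * poly M 0"
      unfolding M(2) using n_ge_2 by (simp add: X_def poly_monom)
    then have "\<pi> * poly M 0 = (- rep 0) ^ n" by (simp add: shift_def)
    also have "\<dots> = (- rep 0)^2 * (- rep 0) ^ (n - 2)"
      using n_ge_2 by (metis le_add_diff_inverse power_add)
    also have "\<dots> = \<pi> * (\<pi> * ((- \<rho>)^2 * (- rep 0) ^ (n - 2)))"
      unfolding \<rho>(2) by (simp add: power2_eq_square)
    finally show ?thesis by (simp only: mult_cancel_left) simp
  qed
  moreover have "(- \<rho>)^2 * (- rep 0) ^ (n - 2) \<in> V"
    using \<rho>(1) by (intro mult_mem power_mem uminus_mem) auto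
  ultimately have M0: "res (poly M 0) = 0"
    using res_eq_0_iff[OF poly_mem[OF M(1) zero_mem]] by blast
  \<comment> \<open>the unit by which \<open>X^(n-1) / \<pi>\<close> is multiplied in \<open>F\<close> modulo \<open>X^n\<close>\<close>
  define N where "N = (\<Prod>a\<in>UNIV - {0}. M + [:rep a:]) * cofactor_at 0"
  have N: "N \<in> polys_over V"
    unfolding N_def by (intro polys.mult_mem polys.prod_mem polys.add_mem M cofactor_at_mem) auto
  have res_N: "res (poly N 0) \<noteq> 0"
  proof -
    have "poly (red M) 0 = 0" using M0 res_poly[OF M(1) zero_mem] by simp
    moreover have "poly (red (cofactor_at 0)) 0 \<noteq> 0"
      using res_cofactor_at_nonzero[of 0] res_poly[OF cofactor_at_mem rep_mem, of 0 0] by simp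
    ultimately have "poly (red N) 0 \<noteq> 0"
      unfolding N_def using M
      by (simp add: red_mult red_prod red_add polys.prod_mem polys.add_mem cofactor_at_mem poly_prod)
    then show ?thesis using res_poly[OF N zero_mem] by simp
  qed
  have "\<exists>E. (\<Prod>a\<in>I. [:1 / \<pi>:] * (shift 0 ^ n + [:\<pi> * rep a:])) = (\<Prod>a\<in>I. M + [:rep a:]) + X ^ n * E"
    if "finite I" for I :: "'f set"
    using that
  proof (induction I)
    case empty
    show ?case by (intro exI[of _ 0]) simp
  next
    case (insert a I)
    then obtain E where E: "(\<Prod>a\<in>I. [:1 / \<pi>:] * (shift 0 ^ n + [:\<pi> * rep a:]))
        = (\<Prod>a\<in>I. M + [:rep a:]) + X ^ n * E" by blast
    have expand: "(m + x * p) * (d + x * e) = m * d + x * (m * e + p * (d + x * e))"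
      for m x p d e :: "'k poly"
      by (simp add: algebra_simps)
    have "[:1 / \<pi>:] * (shift 0 ^ n + [:\<pi> * rep a:]) = (M + [:rep a:]) + X ^ n * [:1 / \<pi>:]"
      unfolding M(2) by (simp add: algebra_simps smult_add_right)
    then have "(\<Prod>a\<in>insert a I. [:1 / \<pi>:] * (shift 0 ^ n + [:\<pi> * rep a:]))
      = ((M + [:rep a:]) + X ^ n * [:1 / \<pi>:]) * ((\<Prod>a\<in>I. M + [:rep a:]) + X ^ n * E)"
      unfolding prod.insert[OF insert.hyps] E by (rule arg_cong[where f = "\<lambda>t. t * _"])
    also have "\<dots> = (\<Prod>a\<in>insert a I. M + [:rep a:])
      + X ^ n * ((M + [:rep a:]) * E + [:1 / \<pi>:] * ((\<Prod>a\<in>I. M + [:rep a:]) + X ^ n * E))"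
      unfolding prod.insert[OF insert.hyps] by (rule expand)
    finally show ?case by blast
  qed
  then obtain E where E: "(\<Prod>a\<in>UNIV - {0}. [:1 / \<pi>:] * (shift 0 ^ n + [:\<pi> * rep a:]))
      = (\<Prod>a\<in>UNIV - {0}. M + [:rep a:]) + X ^ n * E"
    by (metis finite)
  define p where "p = [:1 / \<pi>:]"
  have p: "p * [:\<pi>:] = 1" by (simp add: p_def one_pCons)
  have "F_poly n \<pi> rep prep = p * (X ^ (n - 1) + [:\<pi>:] * M') *
      ((\<Prod>a\<in>UNIV - {0}. M + [:rep a:]) + X ^ n * E) * cofactor_at 0"
    unfolding scaled_G[of 0] E M'(2) p_def ..
  also have "\<dots> = p * X ^ (n - 1) * N + (p * [:\<pi>:]) * M' * N
      + X ^ n * (p * (X ^ (n - 1) + [:\<pi>:] * M') * E * cofactor_at 0)"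
    unfolding N_def by (simp only: distrib_left distrib_right mult_ac add_ac)
  finally have F: "F_poly n \<pi> rep prep = monom 1 (n - 1) * smult (1 / \<pi>) N + M' * N
      + monom 1 n * (p * (X ^ (n - 1) + [:\<pi>:] * M') * E * cofactor_at 0)"
    unfolding p Xk by (simp add: p_def mult_ac)
  have cF: "coeff (F_poly n \<pi> rep prep) (n - 1) = coeff N 0 / \<pi> + coeff (M' * N) (n - 1)"
    unfolding F using n_ge_2 by (simp add: coeff_monom_mult)
  assume "coeff (smult c (F_poly n \<pi> rep prep)) (n - 1) \<in> V"
  then have "c * (coeff N 0 / \<pi>) + c * coeff (M' * N) (n - 1) \<in> V"
    unfolding coeff_smult cF distrib_left .
  moreover have "c * coeff (M' * N) (n - 1) \<in> V"
    by (intro mult_mem c coeff_polys_over polys.mult_mem N M')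
  ultimately have "c * (coeff N 0 / \<pi>) \<in> V"
    using diff_mem by fastforce
  then have "res (\<pi> * (c * (coeff N 0 / \<pi>))) = 0"
    by (simp only: res_mult uniformizer_mem res_uniformizer) simp
  moreover have "\<pi> * (c * (coeff N 0 / \<pi>)) = c * poly N 0" by (simp add: poly_0_coeff_0)
  ultimately have "res (c * poly N 0) = 0" by (simp only:)
  then show False using c res_N by (simp add: res_mult poly_mem N)
qed

end

section \<open>A monic equation for F at one matrix\<close>

text \<open>
  The ring \<open>\<Phi>\<close> stands for the polynomials whose value at a fixed matrix over \<open>V\<close> is integral, and
  \<open>\<chi>\<close> for the characteristic polynomial of that matrix.
\<close>

locale integral_at = residue_lifts V res \<pi> rep prep n
  for V :: "'k::field set" and res :: "'k \<Rightarrow> 'f::{field,finite}" and \<pi> rep prep n +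
  fixes \<Phi> :: "'k poly set" and \<chi> :: "'k poly"
  assumes unital_subring_\<Phi>: "unital_subring \<Phi>"
    and polys_over_\<Phi>: "polys_over V \<subseteq> \<Phi>"
    and \<chi>_mem: "\<chi> \<in> polys_over V"
    and monic_\<chi>: "lead_coeff \<chi> = 1"
    and degree_\<chi>: "degree \<chi> = n"
    and \<chi>_mult_\<Phi>: "\<chi> * f \<in> \<Phi>"
begin

interpretation polys: unital_subring "polys_over V"
  by (rule unital_subring_polys_over)

interpretation \<Phi>: unital_subring \<Phi>
  by (rule unital_subring_\<Phi>)

abbreviation pol\<pi> :: "'k poly" where "pol\<pi> \<equiv> [:\<pi>:]"
abbreviation pol\<pi>_inv :: "'k poly" where "pol\<pi>_inv \<equiv> [:1 / \<pi>:]"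

lemma pol\<pi>_inverse: "pol\<pi>_inv * pol\<pi> = 1"
  by (simp add: one_pCons)

lemma pol\<pi>_mem [simp]: "pol\<pi> \<in> polys_over V"
  by simp

text \<open>
  The filtration of \<open>K[x]\<close> by the \<open>V[x]\<close>-modules \<open>\<pi>^j \<Phi>\<close>; each of them contains \<open>\<chi> K[x]\<close>.
\<close>

definition multiples :: "nat \<Rightarrow> 'k poly set" where
  "multiples j = {pol\<pi> ^ j * f | f. f \<in> \<Phi>}"

lemma multiplesI: "f \<in> \<Phi> \<Longrightarrow> pol\<pi> ^ j * f \<in> multiples j"
  by (auto simp: multiples_def)

lemma multiples_mult: "f \<in> multiples i \<Longrightarrow> g \<in> multiples j \<Longrightarrow> f * g \<in> multiples (i + j)"
proof -
  assume "f \<in> multiples i" "g \<in> multiples j"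
  then obtain f' g' where "f' \<in> \<Phi>" "g' \<in> \<Phi>" "f = pol\<pi> ^ i * f'" "g = pol\<pi> ^ j * g'"
    by (auto simp: multiples_def)
  moreover have "(pol\<pi> ^ i * f') * (pol\<pi> ^ j * g') = pol\<pi> ^ (i + j) * (f' * g')"
    by (simp only: power_add mult_ac)
  ultimately show ?thesis using multiplesI[OF \<Phi>.mult_mem, of f' g' "i + j"] by metis
qed

lemma multiples_0: "multiples 0 = \<Phi>"
  by (auto simp: multiples_def)

lemma multiples_scale: "u \<in> polys_over V \<Longrightarrow> f \<in> multiples j \<Longrightarrow> u * f \<in> multiples j"
  using multiples_mult[of u 0 f j] polys_over_\<Phi> by (auto simp: multiples_0)

lemma multiples_add: "f \<in> multiples j \<Longrightarrow> g \<in> multiples j \<Longrightarrow> f + g \<in> multiples j"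
  unfolding multiples_def by (auto simp: distrib_left[symmetric] intro: \<Phi>.add_mem)

lemma multiples_mono: "f \<in> multiples j \<Longrightarrow> i \<le> j \<Longrightarrow> f \<in> multiples i"
proof -
  assume "f \<in> multiples j" "i \<le> j"
  then obtain f' where f': "f' \<in> \<Phi>" "f = pol\<pi> ^ j * f'" by (auto simp: multiples_def)
  have "pol\<pi> ^ j = pol\<pi> ^ i * pol\<pi> ^ (j - i)" using \<open>i \<le> j\<close> by (simp add: power_add[symmetric])
  then have "f = pol\<pi> ^ i * (pol\<pi> ^ (j - i) * f')" using f' by (simp only: mult.assoc)
  moreover have "pol\<pi> ^ (j - i) * f' \<in> \<Phi>"
    using f' polys_over_\<Phi> polys.power_mem[OF pol\<pi>_mem] by (auto intro: \<Phi>.mult_mem)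
  ultimately show ?thesis using multiplesI by blast
qed

lemma \<chi>_multiples: "\<chi> * f \<in> multiples j"
proof -
  have "\<chi> * f = pol\<pi> ^ j * (\<chi> * (pol\<pi>_inv ^ j * f))"
  proof -
    have "pol\<pi> ^ j * (\<chi> * (pol\<pi>_inv ^ j * f)) = (pol\<pi>_inv * pol\<pi>) ^ j * (\<chi> * f)"
      by (simp only: power_mult_distrib mult_ac)
    then show ?thesis by (simp only: pol\<pi>_inverse) simp
  qed
  then show ?thesis using multiplesI[OF \<chi>_mult_\<Phi>] by metis
qed

lemma multiples_prod:
  "finite I \<Longrightarrow> (\<And>a. a \<in> I \<Longrightarrow> f a \<in> multiples 1) \<Longrightarrow> prod f I \<in> multiples (card I)"
proof (induction I rule: finite_induct)
  case empty
  then show ?case by (simp add: multiples_0)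
next
  case (insert a I)
  then show ?case using multiples_mult[of "f a" 1 "prod f I" "card I"] by auto
qed

lemma multiples_power: "f \<in> multiples 1 \<Longrightarrow> f ^ j \<in> multiples j"
  using multiples_prod[of "{..<j}" "\<lambda>_. f"] by simp

text \<open>
  A multiple of \<open>\<chi>\<close> modulo \<open>\<pi>\<close> differs from a true multiple of \<open>\<chi>\<close>, which lies in every
  \<open>\<pi>^j \<Phi>\<close>, by an element of \<open>\<pi> V[x]\<close>.
\<close>

lemma red_\<chi>_dvd_imp_multiples:
  assumes f: "f \<in> polys_over V" and dvd: "red \<chi> dvd red f"
  shows "f \<in> multiples 1"
proof -
  obtain u where u: "red f = red \<chi> * u" using dvd unfolding dvd_def by blast
  have "red f = red (\<chi> * prep u)" by (simp add: u red_mult \<chi>_mem)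
  then obtain h where h: "h \<in> polys_over V" "f = \<chi> * prep u + pol\<pi> * h"
    using red_eq_imp[OF f polys.mult_mem[OF \<chi>_mem prep_mem]] by blast
  then show ?thesis
    using multiplesI[of h 1] polys_over_\<Phi> \<chi>_multiples[of "prep u" 1]
    by (auto intro: multiples_add)
qed

lemma F_poly_in_\<Phi>: assumes "G \<in> multiples (CARD('f))" shows "F_poly n \<pi> rep prep \<in> \<Phi>"
proof -
  obtain f where f: "f \<in> \<Phi>" "G = pol\<pi> ^ CARD('f) * f" using assms by (auto simp: multiples_def)
  have "F_poly n \<pi> rep prep = f" unfolding F_poly_eq f(2) by (simp add: poly_const_pow)
  then show ?thesis using f by simp
qed

lemma red_\<chi>: "degree (red \<chi>) = n" "lead_coeff (red \<chi>) = 1" "red \<chi> \<noteq> 0"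
proof -
  have 1: "coeff (red \<chi>) n = 1" using monic_\<chi> degree_\<chi> by (simp add: coeff_red)
  moreover have "degree (red \<chi>) \<le> n" using degree_\<chi> degree_map_poly_le by metis
  ultimately show "degree (red \<chi>) = n" by (intro antisym le_degree) auto
  then show "lead_coeff (red \<chi>) = 1" using 1 by simp
  then show "red \<chi> \<noteq> 0" by auto
qed

text \<open>
  Here \<open>g\<close> is the \<open>q\<close>-th power of a lift of the part \<open>u\<close> of \<open>\<chi>\<close> modulo \<open>\<pi>\<close> prime to \<open>f\<close>. The
  polynomial \<open>G\<close> has \<open>q\<close> factors each of which becomes a multiple of \<open>\<chi>\<close> modulo \<open>\<pi>\<close> when multiplied
  by \<open>u\<close>: the \<open>q\<close> copies of \<open>\<theta>\<close> if \<open>deg f \<ge> 2\<close>, and the power of \<open>x - b\<close> together with the \<open>q - 1\<close>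
  binomials of \<open>h(x - b)\<close> if \<open>f = x - b\<close>. In the linear case the exponent \<open>n - 1\<close> suffices because
  \<open>\<chi>\<close> is not \<open>(x - b)^n\<close> modulo \<open>\<pi>\<close>.
\<close>

lemma G_multiples_at_irreducible:
  assumes f: "irreducible f" "lead_coeff f = 1" and nonlocal: "\<And>b. red \<chi> \<noteq> [:- b, 1:] ^ n"
  shows "\<exists>g\<in>polys_over V. \<not> f dvd red g \<and> g * G \<in> multiples (CARD('f))"
proof (cases "f dvd red \<chi>")
  case False
  then show ?thesis using \<chi>_mem \<chi>_multiples by (intro bexI[of _ \<chi>]) auto
next
  case True
  have f0: "f \<noteq> 0" using f by auto
  have df: "degree f \<noteq> 0" using f is_unit_iff_degree[OF f0] by (auto simp: Factorial_Ring.irreducible_def)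
  obtain k u where u: "red \<chi> = f ^ k * u" "\<not> f dvd u"
    using factor_out_power[OF red_\<chi>(3) df] by blast
  have k: "k \<noteq> 0" using True u by (intro notI) simp
  have u0: "u \<noteq> 0" using u by auto
  have deg: "n = k * degree f + degree u"
    using red_\<chi>(1) f0 u0 by (simp add: u(1) degree_mult_eq degree_power_eq mult.commute)
  define g where "g = prep u"
  have g: "g \<in> polys_over V" "red g = u" by (simp_all add: g_def)
  have gq: "\<not> f dvd red (g ^ CARD('f))"
  proof
    assume "f dvd red (g ^ CARD('f))"
    then have "f dvd u ^ CARD('f)" using g by (simp add: red_power)
    then show False
      using prime_elem_dvd_power[OF field_poly_irreducible_imp_prime[OF f(1)]] u(2) by blast
  qed
  have "g ^ CARD('f) * G \<in> multiples (CARD('f))"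
  proof (cases "degree f = 1")
    case True
    then obtain c where c: "f = [:c, 1:]"
      using f(2) by (cases f) (auto split: if_splits elim!: degree_eq_zeroE)
    define b where "b = - c"
    have fb: "f = [:- b, 1:]" by (simp add: b_def c)
    \<comment> \<open>otherwise \<open>\<chi>\<close> would be \<open>(x - b)^n\<close> modulo \<open>\<pi>\<close>\<close>
    have "k \<noteq> n"
    proof
      assume "k = n"
      then have "degree u = 0" using deg True by simp
      moreover have "lead_coeff u = 1"
        using red_\<chi>(2) f(2) by (simp add: u(1) lead_coeff_mult lead_coeff_power)
      ultimately have "u = 1" by (auto elim!: degree_eq_zeroE simp: one_pCons)
      then show False using nonlocal[of b] u(1) fb \<open>k = n\<close> by simp
    qed
    then have kn: "k \<le> n - 1" "k \<le> n" using deg True by auto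
    have 1: "g * shift b ^ (n - 1) \<in> multiples 1"
    proof (rule red_\<chi>_dvd_imp_multiples)
      have "f ^ k * u dvd f ^ (n - 1) * u" using kn by (intro mult_dvd_mono le_imp_power_dvd) auto
      then show "red \<chi> dvd red (g * shift b ^ (n - 1))"
        using g fb by (simp add: u(1) red_mult red_power polys.power_mem mult.commute)
    qed (intro polys.mult_mem polys.power_mem g(1) shift_mem)
    have 2: "g * (shift b ^ n + [:\<pi> * rep a:]) \<in> multiples 1" for a
    proof (rule red_\<chi>_dvd_imp_multiples)
      have "f ^ k * u dvd f ^ n * u" using kn by (intro mult_dvd_mono le_imp_power_dvd) auto
      then show "red \<chi> dvd red (g * (shift b ^ n + [:\<pi> * rep a:]))"
        using g fb by (simp only: u(1) red_mult red_factor factor_mem mult.commute)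
    qed (use g in \<open>auto intro: polys.mult_mem factor_mem\<close>)
    have "(\<Prod>a\<in>UNIV - {0}. g * (shift b ^ n + [:\<pi> * rep a:])) \<in> multiples (CARD('f) - 1)"
      using multiples_prod[of "UNIV - {0}" "\<lambda>a. g * (shift b ^ n + [:\<pi> * rep a:])"] 2 card_nonzero
      by auto
    from multiples_mult[OF 1 this]
    have "g * shift b ^ (n - 1) * (\<Prod>a\<in>UNIV - {0}. g * (shift b ^ n + [:\<pi> * rep a:])) \<in> multiples (CARD('f))"
      using card_residue_field_ge_2 by simp
    from multiples_scale[OF cofactor_at_mem this, of b]
    show ?thesis
    proof (rule back_subst[where P = "\<lambda>x. x \<in> multiples (CARD('f))"])
      have C: "g ^ CARD('f) = g * g ^ (CARD('f) - 1)"
        using card_residue_field_ge_2 by (simp flip: power_Suc)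
      show "cofactor_at b * (g * shift b ^ (n - 1) * (\<Prod>a\<in>UNIV - {0}. g * (shift b ^ n + [:\<pi> * rep a:])))
        = g ^ CARD('f) * G"
        unfolding G_split[of b] h_at_def prod.distrib prod_constant card_nonzero C
        by (simp only: mult_ac)
    qed
  next
    case False
    have "k * degree f \<le> n" using deg by simp
    then have kd: "k \<le> n div degree f" using df by (simp add: less_eq_div_iff_mult_less_eq)
    have "1 * degree f \<le> k * degree f" using k by (intro mult_right_mono) auto
    then have "degree f \<le> n" using deg by linarith
    then have fP: "f \<in> irred_polys n"
      using f df False deg by (auto simp: irred_polys_def)
    have "f ^ k dvd (\<Prod>f\<in>irred_polys n. f ^ (n div degree f))"
      using le_imp_power_dvd[OF kd]
        dvd_prodI[OF finite_irred_polys fP, of "\<lambda>f. f ^ (n div degree f)"] by (rule dvd_trans)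
    then have "f ^ k * u dvd (\<Prod>f\<in>irred_polys n. f ^ (n div degree f)) * u"
      by (intro mult_dvd_mono) auto
    then have "g * theta_poly n prep \<in> multiples 1"
      using g by (intro red_\<chi>_dvd_imp_multiples polys.mult_mem theta_mem)
        (simp_all add: u(1) red_mult theta_mem red_theta mult.commute)
    then have "(g * theta_poly n prep) ^ CARD('f) \<in> multiples (CARD('f))" by (rule multiples_power)
    then have "(\<Prod>b\<in>UNIV. h_at b) * (g * theta_poly n prep) ^ CARD('f) \<in> multiples (CARD('f))"
      by (intro multiples_scale polys.prod_mem h_at_mem)
    then show ?thesis by (simp only: G_def power_mult_distrib mult_ac)
  qed
  then show ?thesis using g gq by (intro bexI[of _ "g ^ CARD('f)"]) (auto intro: polys.power_mem)
qed

text \<open>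
  The multipliers that carry \<open>G\<close> into \<open>\<pi>^q \<Phi>\<close> reduce to an ideal of polynomials over the residue
  field, which is the unit ideal by the preceding lemma. A multiplier \<open>1 - \<pi> r\<close> is as good as \<open>1\<close>:
  from \<open>G = g G + \<pi> r G\<close> the order of \<open>G\<close> in the filtration increases step by step up to \<open>q\<close>.
\<close>

lemma F_poly_integral_if_nonlocal:
  assumes nonlocal: "\<And>b. red \<chi> \<noteq> [:- b, 1:] ^ n"
  shows "F_poly n \<pi> rep prep \<in> \<Phi>"
proof -
  define C where "C = {g \<in> polys_over V. g * G \<in> multiples (CARD('f))}"
  have "1 \<in> red ` C"
  proof (rule poly_ideal_contains_one)
    fix x y assume "x \<in> red ` C" "y \<in> red ` C"
    then obtain g h where gh: "g \<in> C" "h \<in> C" "x = red g" "y = red h" by auto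
    have "g - h \<in> polys_over V" using gh by (auto simp: C_def intro: polys.diff_mem)
    moreover have "(g - h) * G = g * G + (- 1) * (h * G)" by (simp add: algebra_simps)
    moreover have "g * G + (- 1) * (h * G) \<in> multiples (CARD('f))"
      using gh by (intro multiples_add[OF _ multiples_scale] polys.uminus_mem) (auto simp: C_def)
    ultimately have "g - h \<in> C" by (simp only: C_def mem_Collect_eq)
    moreover have "red (g - h) = x - y" using gh by (simp add: red_diff C_def)
    ultimately show "x - y \<in> red ` C" by force
  next
    fix u x assume "x \<in> red ` C"
    then obtain g where g: "g \<in> C" "x = red g" by auto
    then have "prep u * g \<in> C" using multiples_scale[of "prep u" "g * G"]
      by (auto simp: C_def mult.assoc intro: polys.mult_mem)
    moreover have "red (prep u * g) = u * x" using g by (simp add: red_mult C_def)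
    ultimately show "u * x \<in> red ` C" by force
  next
    fix p :: "'f poly" assume "irreducible p" "lead_coeff p = 1"
    from G_multiples_at_irreducible[OF this nonlocal]
    show "\<exists>x\<in>red ` C. \<not> p dvd x" by (auto simp: C_def)
  qed
  then obtain g where g: "g \<in> polys_over V" "red g = 1" "g * G \<in> multiples (CARD('f))"
    by (auto simp: C_def)
  obtain r where r: "r \<in> polys_over V" "1 = g + pol\<pi> * r"
    using red_eq_imp[of 1 g] g by auto
  have "j \<le> CARD('f) \<Longrightarrow> G \<in> multiples j" for j
  proof (induction j)
    case 0
    then show ?case using G_mem polys_over_\<Phi> by (auto simp: multiples_0)
  next
    case (Suc j)
    have "r * G \<in> multiples j" using Suc r by (intro multiples_scale) auto
    then have "pol\<pi> * 1 * (r * G) \<in> multiples (Suc j)"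
      using multiples_mult[OF multiplesI[OF \<Phi>.one_mem, of 1]] by simp
    moreover have "g * G \<in> multiples (Suc j)" using g(3) Suc.prems by (rule multiples_mono)
    ultimately have "g * G + pol\<pi> * 1 * (r * G) \<in> multiples (Suc j)" by (intro multiples_add)
    moreover have "g * G + pol\<pi> * 1 * (r * G) = (g + pol\<pi> * r) * G"
      by (simp only: distrib_right mult.assoc mult_1_right mult_1_left)
    ultimately show ?case using r(2) by simp
  qed
  then show ?thesis by (intro F_poly_in_\<Phi>) simp
qed

text \<open>
  The model case is that of an Eisenstein polynomial \<open>\<chi>\<close>. For \<open>a = res \<rho>\<close> the two terms
  \<open>- \<pi> \<rho>\<close> and \<open>\<pi> rep a\<close> cancel modulo \<open>\<pi>^2\<close>, so \<open>y^n + \<pi> rep a\<close> is \<open>- \<pi> y R1\<close> up to \<open>\<pi>^2\<close>. The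
  extra \<open>y\<close> turns the factor \<open>y^(n-1)\<close> of \<open>h(y)\<close> into \<open>y^n\<close>, which is divisible by \<open>\<pi>\<close>.
\<close>

lemma F_poly_integral_if_ramified:
  assumes R1: "R1 \<in> polys_over V" and \<rho>: "\<rho> \<in> V" "res \<rho> \<noteq> 0"
    and \<chi>: "shift b ^ n = \<chi> - pol\<pi> * (shift b * R1 + [:\<rho>:])"
  shows "F_poly n \<pi> rep prep \<in> \<Phi>"
proof -
  define a where "a = res \<rho>"
  obtain \<epsilon> where \<epsilon>: "\<epsilon> \<in> V" "rep a = \<rho> + \<pi> * \<epsilon>"
    using res_eq_imp[of "rep a" \<rho>] \<rho> by (auto simp: a_def)
  have yn: "shift b ^ n + [:\<pi> * rep a':] \<in> multiples 1" for a'
  proof -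
    have "red (shift b ^ n + [:\<pi> * rep a':]) = red \<chi>"
    proof -
      have "shift b ^ n + [:\<pi> * rep a':] = \<chi> - pol\<pi> * (shift b * R1 + [:\<rho>:] - [:rep a':])"
        unfolding \<chi> by (simp add: algebra_simps smult_add_right smult_diff_right)
      moreover have "shift b * R1 + [:\<rho>:] - [:rep a':] \<in> polys_over V"
        using R1 \<rho> by (intro polys.diff_mem polys.add_mem polys.mult_mem) auto
      ultimately show ?thesis
        by (simp add: red_diff red_mult \<chi>_mem polys.mult_mem del: mult_pCons_left)
    qed
    then show ?thesis by (intro red_\<chi>_dvd_imp_multiples factor_mem) simp
  qed
  have y: "shift b ^ n \<in> multiples 1"
  proof (rule red_\<chi>_dvd_imp_multiples)
    have "shift b * R1 + [:\<rho>:] \<in> polys_over V"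
      using R1 \<rho> by (intro polys.add_mem polys.mult_mem) auto
    then have "red (shift b ^ n) = red \<chi>"
      unfolding \<chi> by (simp add: red_diff red_mult \<chi>_mem polys.mult_mem del: mult_pCons_left)
    then show "red \<chi> dvd red (shift b ^ n)" by simp
  qed (simp add: polys.power_mem)
  have "shift b ^ (n - 1) * (shift b ^ n + [:\<pi> * rep a:]) \<in> multiples 2"
  proof -
    have S: "shift b ^ n = shift b * shift b ^ (n - 1)" using n_ge_2 by (simp flip: power_Suc)
    have e: "[:\<pi> * rep a:] = pol\<pi> * [:\<rho>:] + pol\<pi> ^ 2 * [:\<epsilon>:]"
      unfolding \<epsilon>(2) by (simp add: power2_eq_square algebra_simps)
    have expand: "z * (c - p * (y * r + s) + (p * s + p\<^sup>2 * e))
        = c * z + p\<^sup>2 * (e * z) + (- r) * ((p * 1) * (y * z))" for z c p y r s e :: "'k poly"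
      by (simp add: algebra_simps power2_eq_square)
    have "shift b ^ (n - 1) * (shift b ^ n + [:\<pi> * rep a:])
      = shift b ^ (n - 1) * (\<chi> - pol\<pi> * (shift b * R1 + [:\<rho>:]) + (pol\<pi> * [:\<rho>:] + pol\<pi> ^ 2 * [:\<epsilon>:]))"
      unfolding e \<chi> ..
    also have "\<dots> = \<chi> * shift b ^ (n - 1) + pol\<pi> ^ 2 * ([:\<epsilon>:] * shift b ^ (n - 1))
      + (- R1) * ((pol\<pi> * 1) * (shift b * shift b ^ (n - 1)))"
      by (rule expand)
    finally have eq: "shift b ^ (n - 1) * (shift b ^ n + [:\<pi> * rep a:])
      = \<chi> * shift b ^ (n - 1) + pol\<pi> ^ 2 * ([:\<epsilon>:] * shift b ^ (n - 1))
      + (- R1) * ((pol\<pi> * 1) * shift b ^ n)" unfolding S .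
    have "(pol\<pi> * 1) * shift b ^ n \<in> multiples 2"
      using multiples_mult[OF multiplesI[OF \<Phi>.one_mem, of 1] y] by (simp add: numeral_2_eq_2)
    then have "(- R1) * ((pol\<pi> * 1) * shift b ^ n) \<in> multiples 2"
      by (rule multiples_scale[OF polys.uminus_mem[OF R1]])
    moreover have "[:\<epsilon>:] * shift b ^ (n - 1) \<in> \<Phi>"
      by (intro subsetD[OF polys_over_\<Phi>] polys.mult_mem polys.power_mem shift_mem)
         (simp add: \<epsilon>)
    ultimately show ?thesis
      unfolding eq by (intro multiples_add \<chi>_multiples multiplesI)
  qed
  moreover have "(\<Prod>a\<in>UNIV - {0} - {a}. shift b ^ n + [:\<pi> * rep a:]) \<in> multiples (CARD('f) - 2)"
  proof -
    have "card (UNIV - {0} - {a}) = CARD('f) - 2"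
      using \<rho> card_nonzero by (subst card_Diff_singleton) (auto simp: a_def)
    then show ?thesis
      using multiples_prod[of "UNIV - {0} - {a}" "\<lambda>a. shift b ^ n + [:\<pi> * rep a:]"] yn by simp
  qed
  ultimately have "shift b ^ (n - 1) * (shift b ^ n + [:\<pi> * rep a:]) *
      (\<Prod>a\<in>UNIV - {0} - {a}. shift b ^ n + [:\<pi> * rep a:]) \<in> multiples (2 + (CARD('f) - 2))"
    by (rule multiples_mult)
  moreover have "h_at b = shift b ^ (n - 1) * (shift b ^ n + [:\<pi> * rep a:]) *
      (\<Prod>a\<in>UNIV - {0} - {a}. shift b ^ n + [:\<pi> * rep a:])"
    unfolding h_at_def using \<rho> by (subst prod.remove[of _ a]) (auto simp: a_def mult.assoc)
  moreover have "2 + (CARD('f) - 2) = CARD('f)" using card_residue_field_ge_2 by simp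
  ultimately have "h_at b \<in> multiples (CARD('f))" by (simp only:)
  then have "cofactor_at b * h_at b \<in> multiples (CARD('f))"
    by (rule multiples_scale[OF cofactor_at_mem])
  then show ?thesis by (intro F_poly_in_\<Phi>) (simp add: G_split[of b] mult.commute)
qed


text \<open>
  Since \<open>F\<close> is a multiple of \<open>T = y^(n-1) / \<pi>\<close>, everything rests on the equation \<open>T2\<close> for \<open>T\<close>. It
  holds because \<open>y^(2n-2) / \<pi>^2 = y^(n-2) (y^n / \<pi>^2)\<close>, where \<open>n \<ge> 2\<close> is needed. The product over all
  pairs \<open>(r, s)\<close> serves to have one polynomial for all matrices: the pair that matters depends on
  the matrix.
\<close>

lemma F_poly_root_if_wild:
  assumes R1: "R1 \<in> polys_over V" and \<epsilon>: "\<epsilon> \<in> V"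
    and \<chi>: "shift b ^ n = \<chi> - pol\<pi> * (shift b * R1 + pol\<pi> * [:\<epsilon>:])"
    and rep': "residue_lift V res rep'" and c: "c \<in> V"
  defines "B \<equiv> smult c (F_poly n \<pi> rep prep)"
  shows "(\<Prod>(r, s)\<in>UNIV. (B\<^sup>2 - [:rep' r:] * B - [:rep' s:]) ^ n) \<in> \<Phi>"
proof -
  define T where "T = pol\<pi>_inv * shift b ^ (n - 1)"
  \<comment> \<open>\<open>Q\<close> records congruence to an element of \<open>V[x]\<close> modulo \<open>\<chi> K[x]\<close>\<close>
  define Q where "Q = {u + \<chi> * g | u g. u \<in> polys_over V}"
  define S where "S = {u + v * T + \<chi> * g | u v g. u \<in> polys_over V \<and> v \<in> polys_over V}"
  have QI: "u + \<chi> * g \<in> Q" if "u \<in> polys_over V" for u g using that by (auto simp: Q_def)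
  have SI: "u + v * T + \<chi> * g \<in> S" if "u \<in> polys_over V" "v \<in> polys_over V" for u v g
    using that unfolding S_def by blast
  have T2: "T\<^sup>2 = (- ([:\<epsilon>:] * shift b ^ (n - 2))) + (- R1) * T + \<chi> * (pol\<pi>_inv\<^sup>2 * shift b ^ (n - 2))"
  proof -
    have 1: "shift b ^ (n - 1) = shift b * shift b ^ (n - 2)"
      using n_ge_2 by (simp flip: power_Suc add: Suc_diff_Suc numeral_2_eq_2)
    have 2: "shift b ^ n = shift b * shift b * shift b ^ (n - 2)"
      using n_ge_2 by (metis le_add_diff_inverse power2_eq_square power_add)
    have expand: "p * (y * z) * (p * (y * z)) = p * p * z * (y * y * z)" for p y z :: "'k poly"
      by (simp add: algebra_simps)
    have expand': "p * p * z * (c - d * (y * r + d * e))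
        = c * (p * p * z) - (p * d) * z * (y * r) * p - (p * d) * (p * d) * e * z"
      for p y z c d r e :: "'k poly"
      by (simp add: algebra_simps)
    have reorder: "f - r * t - e = (- e) + (- r) * t + f" for f r t e :: "'k poly"
      by simp
    have "T\<^sup>2 = pol\<pi>_inv * pol\<pi>_inv * shift b ^ (n - 2) * shift b ^ n"
      unfolding T_def power2_eq_square 1 2 by (rule expand)
    also have "\<dots> = \<chi> * (pol\<pi>_inv * pol\<pi>_inv * shift b ^ (n - 2))
        - (pol\<pi>_inv * pol\<pi>) * shift b ^ (n - 2) * (shift b * R1) * pol\<pi>_inv
        - (pol\<pi>_inv * pol\<pi>) * (pol\<pi>_inv * pol\<pi>) * [:\<epsilon>:] * shift b ^ (n - 2)"
      unfolding \<chi> by (rule expand')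
    also have "\<dots> = \<chi> * (pol\<pi>_inv * pol\<pi>_inv * shift b ^ (n - 2))
        - R1 * (pol\<pi>_inv * (shift b * shift b ^ (n - 2))) - [:\<epsilon>:] * shift b ^ (n - 2)"
      unfolding pol\<pi>_inverse by (simp only: mult_1_left mult_ac)
    finally show ?thesis unfolding T_def 1 power2_eq_square reorder .
  qed
  define \<epsilon>' where "\<epsilon>' = - ([:\<epsilon>:] * shift b ^ (n - 2))"
  define \<gamma> where "\<gamma> = pol\<pi>_inv\<^sup>2 * shift b ^ (n - 2)"
  have \<epsilon>': "\<epsilon>' \<in> polys_over V"
    unfolding \<epsilon>'_def using \<epsilon> by (intro polys.uminus_mem polys.mult_mem polys.power_mem) auto
  have T2': "T * T = \<epsilon>' + (- R1) * T + \<chi> * \<gamma>"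
    using T2 by (simp only: \<epsilon>'_def \<gamma>_def power2_eq_square)
  have "unital_subring Q"
  proof
    show "1 \<in> Q" using QI[of 1 0] by simp
    fix x y assume "x \<in> Q" "y \<in> Q"
    then obtain u g u' g' where xy: "x = u + \<chi> * g" "y = u' + \<chi> * g'"
      "u \<in> polys_over V" "u' \<in> polys_over V" by (auto simp: Q_def)
    have "x - y = (u - u') + \<chi> * (g - g')" by (simp add: xy algebra_simps)
    then show "x - y \<in> Q" using QI[of "u - u'"] polys.diff_mem[OF xy(3,4)] by simp
    have "x * y = u * u' + \<chi> * (u * g' + g * u' + g * (\<chi> * g'))" by (simp add: xy algebra_simps)
    then show "x * y \<in> Q" using QI[of "u * u'"] polys.mult_mem[OF xy(3,4)] by metis
  qed
  then interpret Q: unital_subring Q .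
  have "unital_subring S"
  proof
    show "1 \<in> S" using SI[of 1 0 0] by simp
    fix x y assume "x \<in> S" "y \<in> S"
    then obtain u v g u' v' g' where xy: "x = u + v * T + \<chi> * g" "y = u' + v' * T + \<chi> * g'"
      and m: "u \<in> polys_over V" "u' \<in> polys_over V" "v \<in> polys_over V" "v' \<in> polys_over V"
      unfolding S_def by blast
    have "x - y = (u - u') + (v - v') * T + \<chi> * (g - g')" by (simp add: xy algebra_simps)
    then show "x - y \<in> S" using SI[of "u - u'" "v - v'"] polys.diff_mem m by metis
    have "x * y = u * u' + (u * v' + v * u') * T + v * v' * (T * T)
      + \<chi> * ((u + v * T) * g' + g * (u' + v' * T) + g * (\<chi> * g'))" by (simp add: xy algebra_simps)
    also have "\<dots> = (u * u' + v * v' * \<epsilon>') + (u * v' + v * u' + v * v' * (- R1)) * T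
      + \<chi> * (v * v' * \<gamma> + ((u + v * T) * g' + g * (u' + v' * T) + g * (\<chi> * g')))"
      unfolding T2' by (simp add: algebra_simps)
    finally have xy': "x * y = \<dots>" .
    show "x * y \<in> S" unfolding xy' using m \<epsilon>' R1
      by (intro SI polys.add_mem polys.mult_mem polys.uminus_mem)
  qed
  then interpret S: unital_subring S .
  have polys_S: "u \<in> S" if "u \<in> polys_over V" for u using SI[OF that polys.zero_mem, of 0] by simp
  have \<chi>_S: "\<chi> * g \<in> S" for g using SI[OF polys.zero_mem polys.zero_mem, of g] by simp
  have S_\<Phi>: "pol\<pi> * x \<in> \<Phi>" if "x \<in> S" for x
  proof -
    obtain u v g where x: "x = u + v * T + \<chi> * g" "u \<in> polys_over V" "v \<in> polys_over V"
      using \<open>x \<in> S\<close> unfolding S_def by blast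
    have "pol\<pi> * x = pol\<pi> * u + v * ((pol\<pi>_inv * pol\<pi>) * shift b ^ (n - 1)) + \<chi> * (pol\<pi> * g)"
      unfolding x(1) T_def by (simp only: distrib_left mult_ac)
    then have "pol\<pi> * x = (pol\<pi> * u + v * shift b ^ (n - 1)) + \<chi> * (pol\<pi> * g)"
      unfolding pol\<pi>_inverse by (simp only: mult_1_left)
    moreover have "pol\<pi> * u + v * shift b ^ (n - 1) \<in> \<Phi>"
      using x by (intro subsetD[OF polys_over_\<Phi>] polys.add_mem polys.mult_mem polys.power_mem) auto
    ultimately show ?thesis using \<chi>_mult_\<Phi>[of "pol\<pi> * g"] \<Phi>.add_mem by metis
  qed
  have factor_Q: "pol\<pi>_inv * (shift b ^ n + [:\<pi> * rep a:]) \<in> Q" for a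
  proof -
    have p: "[:\<pi> * rep a:] = pol\<pi> * [:rep a:]" by simp
    have expand: "p * (c - d * (y * r + d * e) + d * f) = (p * d) * (f - (y * r + d * e)) + c * p"
      for p c d y r e f :: "'k poly"
      by (simp add: algebra_simps)
    have "pol\<pi>_inv * (shift b ^ n + [:\<pi> * rep a:])
      = (pol\<pi>_inv * pol\<pi>) * ([:rep a:] - (shift b * R1 + pol\<pi> * [:\<epsilon>:])) + \<chi> * pol\<pi>_inv"
      unfolding p \<chi> by (rule expand)
    then have eq: "pol\<pi>_inv * (shift b ^ n + [:\<pi> * rep a:])
      = ([:rep a:] - (shift b * R1 + pol\<pi> * [:\<epsilon>:])) + \<chi> * pol\<pi>_inv"
      unfolding pol\<pi>_inverse by (simp only: mult_1_left)
    show ?thesis unfolding eq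
      using R1 \<epsilon> by (intro QI polys.diff_mem polys.add_mem polys.mult_mem) auto
  qed
  have QI': "u \<in> Q" if "u \<in> polys_over V" for u using QI[OF that, of 0] by simp
  have "[:c:] * ((\<Prod>a\<in>UNIV - {0}. pol\<pi>_inv * (shift b ^ n + [:\<pi> * rep a:])) * cofactor_at b) \<in> Q"
    using c by (intro Q.mult_mem[OF QI' Q.mult_mem[OF Q.prod_mem QI']] factor_Q cofactor_at_mem) simp
  then obtain w g where w: "w \<in> polys_over V"
    and wg: "[:c:] * ((\<Prod>a\<in>UNIV - {0}. pol\<pi>_inv * (shift b ^ n + [:\<pi> * rep a:])) * cofactor_at b) = w + \<chi> * g"
    by (auto simp: Q_def)
  have "B = T * ([:c:] * ((\<Prod>a\<in>UNIV - {0}. pol\<pi>_inv * (shift b ^ n + [:\<pi> * rep a:])) * cofactor_at b))"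
  proof -
    have "B = [:c:] * F_poly n \<pi> rep prep" by (simp add: B_def)
    then show ?thesis unfolding scaled_G[of b] T_def by (simp only: mult_ac)
  qed
  then have B: "B = w * T + \<chi> * (T * g)" unfolding wg by (simp only: distrib_left mult_ac)
  have B_S: "B \<in> S" using SI[OF polys.zero_mem w, of "T * g"] B by simp
  \<comment> \<open>\<open>B\<close> is \<open>w T\<close> modulo \<open>\<chi> K[x]\<close>, so the equation of \<open>T\<close> becomes \<open>B^2 = \<alpha> B + \<beta>\<close>\<close>
  define \<alpha> where "\<alpha> = w * (- R1)"
  define \<beta> where "\<beta> = w * w * \<epsilon>'"
  have \<alpha>\<beta>: "\<alpha> \<in> polys_over V" "\<beta> \<in> polys_over V"
    unfolding \<alpha>_def \<beta>_def using w R1 \<epsilon>' by (auto intro!: polys.mult_mem polys.uminus_mem)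
  have "B * B = w * w * (T * T) + \<chi> * ((w * T) * (T * g) * 2 + \<chi> * (T * g) * (T * g))"
    unfolding B by (simp add: algebra_simps)
  also have "\<dots> = \<alpha> * B + \<beta> + \<chi> * (w * w * \<gamma> - \<alpha> * (T * g)
      + ((w * T) * (T * g) * 2 + \<chi> * (T * g) * (T * g)))"
    unfolding T2' \<alpha>_def \<beta>_def B by (simp add: algebra_simps)
  finally obtain \<delta> where B2: "B\<^sup>2 = \<alpha> * B + \<beta> + \<chi> * \<delta>" unfolding power2_eq_square by blast
  have lin: "\<exists>r. \<exists>u\<in>polys_over V. \<exists>v\<in>polys_over V. f = [:rep' r:] + shift b * u + pol\<pi> * v"
    if f: "f \<in> polys_over V" for f
  proof -
    obtain u where u: "u \<in> polys_over V" "f = shift b * u + [:poly f (rep b):]"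
      using divide_linear_polys_over[OF rep_mem[of b] f] by (auto simp: shift_def)
    have pf: "poly f (rep b) \<in> V" using f by (intro poly_mem) auto
    define r where "r = res (poly f (rep b))"
    have rr: "rep' r \<in> V" "res (rep' r) = r" using rep' by (auto simp: residue_lift_def)
    obtain z where z: "z \<in> V" "poly f (rep b) = rep' r + \<pi> * z"
      using res_eq_imp[OF pf rr(1)] rr(2) r_def by auto
    have "f = [:rep' r:] + shift b * u + pol\<pi> * [:z:]"
      by (subst u(2), subst z(2)) simp
    then show ?thesis using u(1) z(1) by (intro exI[of _ r] bexI[of _ u] bexI[of _ "[:z:]"]) auto
  qed
  obtain r u v where r: "u \<in> polys_over V" "v \<in> polys_over V" "\<alpha> = [:rep' r:] + shift b * u + pol\<pi> * v"
    using lin[OF \<alpha>\<beta>(1)] by blast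
  obtain s u' v' where s: "u' \<in> polys_over V" "v' \<in> polys_over V" "\<beta> = [:rep' s:] + shift b * u' + pol\<pi> * v'"
    using lin[OF \<alpha>\<beta>(2)] by blast
  \<comment> \<open>only the constant residues of \<open>\<alpha>\<close> and \<open>\<beta>\<close> are kept, which leaves \<open>Z\<close> in \<open>y S + \<pi> S\<close>\<close>
  define Z where "Z = B\<^sup>2 - [:rep' r:] * B - [:rep' s:]"
  define s1 where "s1 = u * B + u'"
  define s2 where "s2 = v * B + v' + \<chi> * (pol\<pi>_inv * \<delta>)"
  have s1: "s1 \<in> S" and s2: "s2 \<in> S"
    unfolding s1_def s2_def using r(1,2) s(1,2)
    by (simp_all add: S.add_mem S.mult_mem[OF polys_S B_S] polys_S \<chi>_S del: mult_pCons_left)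
  have Z: "Z = shift b * s1 + pol\<pi> * s2"
  proof -
    have "\<chi> * \<delta> = \<chi> * ((pol\<pi>_inv * pol\<pi>) * \<delta>)" unfolding pol\<pi>_inverse by simp
    then have \<delta>: "\<chi> * \<delta> = pol\<pi> * (\<chi> * (pol\<pi>_inv * \<delta>))" by (simp only: mult_ac)
    have expand: "(r0 + y * u + p * v) * b + (s0 + y * u' + p * v') + p * d - r0 * b - s0
      = y * (u * b + u') + p * (v * b + v' + d)" for r0 y u p v b s0 u' v' d :: "'k poly"
      by (simp add: algebra_simps)
    show ?thesis unfolding Z_def s1_def s2_def B2 \<delta> unfolding r(3) s(3) by (rule expand)
  qed
  have pow: "\<exists>e\<in>S. (x + pol\<pi> * z) ^ k = x ^ k + pol\<pi> * e" if "x \<in> S" "z \<in> S" for x z k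
  proof (induction k)
    case 0
    show ?case by (intro bexI[of _ 0]) auto
  next
    case (Suc k)
    then obtain e where e: "e \<in> S" "(x + pol\<pi> * z) ^ k = x ^ k + pol\<pi> * e" by blast
    have "(x + pol\<pi> * z) ^ Suc k = x ^ Suc k + pol\<pi> * (x * e + z * x ^ k + z * (pol\<pi> * e))"
      unfolding power_Suc e(2) by (simp add: algebra_simps)
    moreover have "x * e + z * x ^ k + z * (pol\<pi> * e) \<in> S"
      using that e polys_S[OF pol\<pi>_mem] by (intro S.add_mem S.mult_mem S.power_mem)
    ultimately show ?case by blast
  qed
  have "\<exists>e\<in>S. Z ^ n = pol\<pi> * e"
  proof -
    have "shift b * s1 \<in> S" using s1 polys_S[OF shift_mem] by (intro S.mult_mem)
    then obtain e where e: "e \<in> S" "Z ^ n = (shift b * s1) ^ n + pol\<pi> * e"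
      using pow[OF _ s2] Z by metis
    have "\<chi> = \<chi> * (pol\<pi>_inv * pol\<pi>)" unfolding pol\<pi>_inverse by simp
    then have \<chi>': "\<chi> = pol\<pi> * (\<chi> * pol\<pi>_inv)" by (simp only: mult_ac)
    have yn: "shift b ^ n = pol\<pi> * (\<chi> * pol\<pi>_inv - (shift b * R1 + pol\<pi> * [:\<epsilon>:]))"
      unfolding \<chi> right_diff_distrib by (subst \<chi>') (rule refl)
    have "Z ^ n = pol\<pi> * ((\<chi> * pol\<pi>_inv - (shift b * R1 + pol\<pi> * [:\<epsilon>:])) * s1 ^ n + e)"
      unfolding e(2) power_mult_distrib yn by (simp only: distrib_left mult.assoc)
    moreover have "(\<chi> * pol\<pi>_inv - (shift b * R1 + pol\<pi> * [:\<epsilon>:])) * s1 ^ n + e \<in> S"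
    proof -
      have "shift b * R1 + pol\<pi> * [:\<epsilon>:] \<in> polys_over V"
        using R1 \<epsilon> by (intro polys.add_mem polys.mult_mem) auto
      then show ?thesis
        by (intro S.add_mem[OF S.mult_mem[OF S.diff_mem[OF \<chi>_S polys_S] S.power_mem]] e(1) s1)
    qed
    ultimately show ?thesis by blast
  qed
  then obtain e where e: "e \<in> S" "Z ^ n = pol\<pi> * e" by blast
  have rep'_S: "[:rep' a:] \<in> S" for a
    using rep' by (intro polys_S) (auto simp: residue_lift_def)
  have "(\<Prod>(r, s)\<in>UNIV - {(r, s)}. (B\<^sup>2 - [:rep' r:] * B - [:rep' s:]) ^ n) \<in> S"
    using B_S rep'_S
    by (auto intro!: S.prod_mem S.power_mem S.diff_mem S.mult_mem simp del: mult_pCons_left)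
  with e(1) have "e * (\<Prod>(r, s)\<in>UNIV - {(r, s)}. (B\<^sup>2 - [:rep' r:] * B - [:rep' s:]) ^ n) \<in> S"
    by (rule S.mult_mem)
  from S_\<Phi>[OF this]
  have "Z ^ n * (\<Prod>(r, s)\<in>UNIV - {(r, s)}. (B\<^sup>2 - [:rep' r:] * B - [:rep' s:]) ^ n) \<in> \<Phi>"
    unfolding e(2) by (simp only: mult.assoc)
  moreover have "(\<Prod>(r, s)\<in>UNIV. (B\<^sup>2 - [:rep' r:] * B - [:rep' s:]) ^ n)
      = Z ^ n * (\<Prod>(r, s)\<in>UNIV - {(r, s)}. (B\<^sup>2 - [:rep' r:] * B - [:rep' s:]) ^ n)"
    by (subst prod.remove[of _ "(r, s)"]) (auto simp: Z_def)
  ultimately show ?thesis by (simp only:)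
qed

lemma F_poly_root_mod_\<Phi>:
  assumes rep': "residue_lift V res rep'" and c: "c \<in> V"
  defines "B \<equiv> smult c (F_poly n \<pi> rep prep)"
  shows "(\<Prod>(r, s)\<in>UNIV. (B\<^sup>2 - [:rep' r:] * B - [:rep' s:]) ^ n) \<in> \<Phi>"
proof (cases "F_poly n \<pi> rep prep \<in> \<Phi>")
  case True
  have const: "[:x:] \<in> \<Phi>" if "x \<in> V" for x
    using polys_over_\<Phi> that by auto
  have "B = [:c:] * F_poly n \<pi> rep prep" by (simp add: B_def)
  then have "B \<in> \<Phi>" using \<Phi>.mult_mem[OF const[OF c] True] by (simp only:)
  then show ?thesis using rep' const
    by (auto intro!: \<Phi>.prod_mem \<Phi>.power_mem \<Phi>.diff_mem \<Phi>.mult_mem simp: residue_lift_def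
        simp del: mult_pCons_left)
next
  case False
  then obtain b where b: "red \<chi> = [:- b, 1:] ^ n" using F_poly_integral_if_nonlocal by blast
  have "red \<chi> = red (shift b ^ n)" by (simp add: b red_power)
  then obtain R where R: "R \<in> polys_over V" "\<chi> = shift b ^ n + pol\<pi> * R"
    using red_eq_imp[OF \<chi>_mem polys.power_mem[OF shift_mem]] by blast
  obtain R1 where R1: "R1 \<in> polys_over V" "R = shift b * R1 + [:poly R (rep b):]"
    using divide_linear_polys_over[OF rep_mem[of b] R(1)] by (auto simp: shift_def)
  define \<rho> where "\<rho> = poly R (rep b)"
  have \<rho>: "\<rho> \<in> V" unfolding \<rho>_def using R by (intro poly_mem) auto
  have eq: "shift b ^ n = \<chi> - pol\<pi> * (shift b * R1 + [:\<rho>:])"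
  proof -
    have "shift b ^ n = \<chi> - pol\<pi> * R" using R(2) by simp
    then show ?thesis using R1(2) unfolding \<rho>_def by (simp only:)
  qed
  then have "res \<rho> = 0"
    using F_poly_integral_if_ramified[OF R1(1) \<rho>] False by blast
  then obtain \<epsilon> where \<epsilon>: "\<epsilon> \<in> V" "\<rho> = \<pi> * \<epsilon>" using res_eq_0_iff[OF \<rho>] by blast
  have "[:\<rho>:] = pol\<pi> * [:\<epsilon>:]" by (simp add: \<epsilon>)
  then show ?thesis
    using F_poly_root_if_wild[OF R1(1) \<epsilon>(1) _ rep' c, of b] eq unfolding B_def by (simp only:)
qed

end

section \<open>Prime ideals and localization\<close>

lemma unital_subring_range_to_fract: "unital_subring (range to_fract)"
proof
  show "1 \<in> range to_fract" by (intro image_eqI[of _ _ 1]) auto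
qed (auto simp flip: to_fract_diff to_fract_mult)

lemma to_fract_power: "to_fract (x ^ k) = to_fract x ^ k"
  by (induction k) auto

lemma to_fract_prod: "to_fract (prod f I) = (\<Prod>i\<in>I. to_fract (f i))"
  by (induction I rule: infinite_finite_induct) auto

lemma ideal_UNIV_D:
  assumes "ideal I (ring_on UNIV)"
  shows "0 \<in> I" "a \<in> I \<Longrightarrow> b \<in> I \<Longrightarrow> a + b \<in> I" "a \<in> I \<Longrightarrow> x * a \<in> I"
  using assms by (simp_all add: ideal_UNIV_iff)

lemma primeideal_UNIV_D:
  assumes "primeideal P (ring_on UNIV)"
  shows "ideal P (ring_on UNIV)" "1 \<notin> P" "a * b \<in> P \<Longrightarrow> a \<in> P \<or> b \<in> P"
proof -
  interpret primeideal P "ring_on UNIV" by fact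
  show I: "ideal P (ring_on UNIV)" by (rule is_ideal)
  show "a * b \<in> P \<Longrightarrow> a \<in> P \<or> b \<in> P" using I_prime[of a b] by (simp add: ring_on_def)
  show "1 \<notin> P"
  proof
    assume "1 \<in> P"
    then have "x * 1 \<in> P" for x using ideal_UNIV_D(3)[OF I] by blast
    then show False using I_notcarr by (auto simp: ring_on_def)
  qed
qed

lemma maximalideal_UNIV_inverse_mod:
  fixes P :: "'a::comm_ring_1 set"
  assumes "maximalideal P (ring_on UNIV)" "s \<notin> P"
  shows "\<exists>t. 1 - s * t \<in> P"
proof -
  interpret maximalideal P "ring_on UNIV" by fact
  have P: "0 \<in> P" "\<And>a b. a \<in> P \<Longrightarrow> b \<in> P \<Longrightarrow> a + b \<in> P" "\<And>a x. a \<in> P \<Longrightarrow> x * a \<in> P"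
    using ideal_UNIV_D[OF is_ideal] by auto
  define J where "J = {x + s * t | x t. x \<in> P}"
  have JI: "x + s * t \<in> J" if "x \<in> P" for x t using that by (auto simp: J_def)
  have "ideal J (ring_on UNIV)" unfolding ideal_UNIV_iff
  proof (intro conjI ballI allI)
    show "0 \<in> J" using JI[OF P(1), of 0] by simp
  next
    fix a b assume "a \<in> J" "b \<in> J"
    then obtain x t x' t' where x: "a = x + s * t" "b = x' + s * t'" "x \<in> P" "x' \<in> P"
      by (auto simp: J_def)
    have "a + b = (x + x') + s * (t + t')" by (simp add: x algebra_simps)
    then show "a + b \<in> J" using JI P(2)[OF x(3,4)] by metis
  next
    fix a z assume "a \<in> J"
    then obtain x t where x: "a = x + s * t" "x \<in> P" by (auto simp: J_def)
    have "z * a = z * x + s * (z * t)" by (simp add: x algebra_simps)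
    then show "z * a \<in> J" using JI P(3)[OF x(2)] by metis
  qed
  moreover have "P \<subseteq> J" using JI[of _ 0] by auto
  ultimately have "J = P \<or> J = UNIV" using I_maximal[of J] by (simp add: ring_on_def)
  moreover have "s \<in> J" using JI[OF P(1), of 1] by simp
  ultimately have "1 \<in> J" using assms(2) by auto
  then obtain x t where "1 = x + s * t" "x \<in> P" by (auto simp: J_def)
  moreover from this have "1 - s * t = x" by (metis add_diff_cancel_right')
  ultimately have "1 - s * t \<in> P" by simp
  then show ?thesis by blast
qed

lemma noetherian_maximal_element:
  fixes \<I> :: "'d::idom set set"
  assumes "noetherian_domain (ring_on (UNIV :: 'd set))"
    and "\<I> \<noteq> {}" "\<And>I. I \<in> \<I> \<Longrightarrow> ideal I (ring_on UNIV)"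
  shows "\<exists>M\<in>\<I>. \<forall>I\<in>\<I>. M \<subseteq> I \<longrightarrow> I = M"
proof (rule subset_Zorn_nonempty)
  interpret noetherian_domain "ring_on (UNIV :: 'd set)" by fact
  fix \<C> assume C: "\<C> \<noteq> {}" "subset.chain \<I> \<C>"
  then have "subset.chain {I. ideal I (ring_on UNIV)} \<C>"
    using assms(3) by (auto simp: subset_chain_def)
  from ideal_chain_is_trivial[OF C(1) this] C(2) show "\<Union>\<C> \<in> \<I>"
    by (auto simp: subset_chain_def)
qed (use assms in auto)

locale residue_at_prime =
  fixes P :: "'d::idom set" and res :: "'d fract \<Rightarrow> 'f::{field,finite}"
  assumes dedekind: "dedekind_domain TYPE('d)"
    and prime: "primeideal P (ring_on UNIV)"
    and nonzero: "P \<noteq> {0}"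
    and residue_map: "residue_map (localization_at P) res"
begin

lemma noetherian: "noetherian_domain (ring_on (UNIV :: 'd set))"
  using dedekind by (simp add: dedekind_domain_def)

lemma prime_imp_maximal:
  "primeideal Q (ring_on UNIV) \<Longrightarrow> Q \<noteq> {0} \<Longrightarrow> maximalideal Q (ring_on (UNIV :: 'd set))"
  using dedekind by (simp add: dedekind_domain_def)

lemma P_closed: "0 \<in> P" "a \<in> P \<Longrightarrow> b \<in> P \<Longrightarrow> a + b \<in> P" "a \<in> P \<Longrightarrow> x * a \<in> P"
  using ideal_UNIV_D[OF primeideal_UNIV_D(1)[OF prime]] by auto

lemma P_diff: "a \<in> P \<Longrightarrow> b \<in> P \<Longrightarrow> a - b \<in> P"
  using P_closed(2)[of a "- b"] P_closed(3)[of b "- 1"] by simp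

lemma not_P: "1 \<notin> P" "a \<notin> P \<Longrightarrow> b \<notin> P \<Longrightarrow> a * b \<notin> P"
  using primeideal_UNIV_D[OF prime] by blast+

lemma not_P_nonzero: "s \<notin> P \<Longrightarrow> s \<noteq> 0"
  using P_closed(1) by auto

lemma inverse_mod_P: "s \<notin> P \<Longrightarrow> \<exists>t. 1 - s * t \<in> P"
  using maximalideal_UNIV_inverse_mod prime_imp_maximal[OF prime nonzero] by blast

abbreviation V :: "'d fract set" where "V \<equiv> localization_at P"
abbreviation D :: "'d fract set" where "D \<equiv> range to_fract"

lemma localizationE:
  assumes "z \<in> V"
  obtains a s where "s \<notin> P" "z = to_fract a / to_fract s"
  using assms by (auto simp: localization_at_def)

lemma localizationI: "s \<notin> P \<Longrightarrow> to_fract a / to_fract s \<in> V"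
  by (auto simp: localization_at_def)

lemma D_subset_V: "D \<subseteq> V"
proof
  fix z assume "z \<in> D"
  then obtain a where "z = to_fract a" by auto
  then show "z \<in> V" using localizationI[OF not_P(1), of a] by simp
qed

lemma to_fract_mem_V [simp]: "to_fract a \<in> V"
  using D_subset_V by auto

lemma unital_subring_V: "unital_subring V"
proof
  show "1 \<in> V" using D_subset_V unital_subring.one_mem[OF unital_subring_range_to_fract] by auto
  fix x y assume "x \<in> V" "y \<in> V"
  then obtain a s b t where xy: "s \<notin> P" "x = to_fract a / to_fract s"
    "t \<notin> P" "y = to_fract b / to_fract t" by (elim localizationE)
  have "x - y = to_fract (a * t - b * s) / to_fract (s * t)"
    using not_P_nonzero[OF xy(1)] not_P_nonzero[OF xy(3)] unfolding xy(2,4) by (simp add: field_simps)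
  then show "x - y \<in> V" using localizationI[OF not_P(2)[OF xy(1,3)]] by metis
  have "x * y = to_fract (a * b) / to_fract (s * t)"
    using xy by simp
  then show "x * y \<in> V" using localizationI[OF not_P(2)[OF xy(1,3)]] by metis
qed

interpretation V: unital_subring V by (rule unital_subring_V)

lemma res_hom: "res 1 = 1" "x \<in> V \<Longrightarrow> y \<in> V \<Longrightarrow> res (x + y) = res x + res y"
    "x \<in> V \<Longrightarrow> y \<in> V \<Longrightarrow> res (x * y) = res x * res y"
  and res_surj: "\<exists>x\<in>V. res x = a"
proof -
  have h: "res \<in> Ring.ring_hom (ring_on V) (ring_on UNIV)" and s: "res ` V = UNIV"
    using residue_map by (auto simp: residue_map_def)
  show "res 1 = 1" using ring_hom_one[OF h] by (simp add: ring_on_def)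
  show "x \<in> V \<Longrightarrow> y \<in> V \<Longrightarrow> res (x + y) = res x + res y"
    using ring_hom_add[OF h, of x y] by (simp add: ring_on_def)
  show "x \<in> V \<Longrightarrow> y \<in> V \<Longrightarrow> res (x * y) = res x * res y"
    using ring_hom_mult[OF h, of x y] by (simp add: ring_on_def)
  have "a \<in> res ` V" using s by simp
  then show "\<exists>x\<in>V. res x = a" by auto
qed

lemma res_zero: "res 0 = 0"
  using res_hom(2)[OF V.zero_mem V.zero_mem] by (metis add.right_neutral add_left_cancel)

text \<open>
  If some \<open>a \<in> P\<close> had nonzero residue, then surjectivity of \<open>res\<close> would give \<open>v \<in> V\<close> with \<open>1 + a v\<close>
  of residue \<open>0\<close>; but \<open>1 + a v\<close> is a unit, as \<open>V\<close> is local.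
\<close>

lemma res_eq_0_iff_P: "res (to_fract a) = 0 \<longleftrightarrow> a \<in> P"
proof
  assume 0: "res (to_fract a) = 0"
  show "a \<in> P"
  proof (rule ccontr)
    assume a: "a \<notin> P"
    have "to_fract a * (to_fract 1 / to_fract a) = 1" using not_P_nonzero[OF a] by simp
    then have "res (to_fract a) * res (to_fract 1 / to_fract a) = 1"
      using res_hom(1,3) localizationI[OF a, of 1] by (metis to_fract_mem_V)
    then show False using 0 by simp
  qed
next
  assume a: "a \<in> P"
  show "res (to_fract a) = 0"
  proof (rule ccontr)
    assume n0: "res (to_fract a) \<noteq> 0"
    obtain v where v: "v \<in> V" "res v = - 1 / res (to_fract a)" using res_surj by blast
    obtain b s where s: "s \<notin> P" "v = to_fract b / to_fract s" using v(1) by (rule localizationE)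
    have sa: "s + a * b \<notin> P"
    proof
      assume "s + a * b \<in> P"
      then have "(s + a * b) - b * a \<in> P" by (intro P_diff P_closed(3) a)
      then show False using s(1) by (simp add: mult.commute)
    qed
    have "res (1 + to_fract a * v) = 0"
      using res_hom v n0 V.mult_mem V.one_mem to_fract_mem_V by simp
    moreover have "(1 + to_fract a * v) * (to_fract s / to_fract (s + a * b)) = 1"
    proof -
      have nz: "to_fract s \<noteq> 0" "to_fract (s + a * b) \<noteq> 0" using not_P_nonzero[OF s(1)] not_P_nonzero[OF sa] by (simp_all only: to_fract_eq_0_iff not_False_eq_True)
      have "1 + to_fract a * v = to_fract (s + a * b) / to_fract s"
        unfolding s(2) using nz(1) by (simp add: field_simps)
      then show ?thesis using nz by simp
    qed
    moreover have "1 + to_fract a * v \<in> V" by (intro V.add_mem V.mult_mem v) auto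
    ultimately show False using res_hom(1,3) localizationI[OF sa, of s] by (metis mult_zero_left zero_neq_one)
  qed
qed

text \<open>
  The elements \<open>a / s\<close> with \<open>a\<close> in \<open>P\<close> (\<open>max_ideal_eq_fractions\<close>), described through the residue map.
\<close>

definition max_ideal :: "'d fract set" where
  "max_ideal = {z \<in> V. res z = 0}"

lemma res_nonzero_imp_unit:
  assumes "z \<in> V" "res z \<noteq> 0"
  shows "inverse z \<in> V" "z \<noteq> 0"
proof -
  show z0: "z \<noteq> 0" using assms res_zero by auto
  obtain a s where s: "s \<notin> P" "z = to_fract a / to_fract s" using assms(1) by (rule localizationE)
  have "z * to_fract s = to_fract a" using s not_P_nonzero by simp
  then have "res (to_fract a) = res z * res (to_fract s)" using res_hom(3)[OF assms(1)] to_fract_mem_V by metis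
  then have "a \<notin> P" using assms(2) s(1) res_eq_0_iff_P by (metis mult_eq_0_iff)
  then show "inverse z \<in> V" using localizationI[of a s] s by simp
qed

lemma max_ideal_eq_fractions:
  assumes "z \<in> max_ideal" shows "\<exists>a s. a \<in> P \<and> s \<notin> P \<and> z = to_fract a / to_fract s"
proof -
  have z: "z \<in> V" "res z = 0" using assms by (auto simp: max_ideal_def)
  obtain a s where s: "s \<notin> P" "z = to_fract a / to_fract s" using z(1) by (rule localizationE)
  have "z * to_fract s = to_fract a" using s not_P_nonzero by simp
  then have "res (to_fract a) = res z * res (to_fract s)" using res_hom(3)[OF z(1)] to_fract_mem_V by metis
  then show ?thesis using z s res_eq_0_iff_P by auto
qed

lemma ideal_max_ideal: "ideal max_ideal (ring_on V)"
  unfolding V.ideal_ring_on_iff max_ideal_def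
  by (auto simp: res_hom res_zero intro: V.add_mem V.mult_mem)

lemma maximalideal_max_ideal: "maximalideal max_ideal (ring_on V)"
proof (rule maximalidealI[OF ideal_max_ideal])
  show "carrier (ring_on V) \<noteq> max_ideal"
  proof
    assume "carrier (ring_on V) = max_ideal"
    then have "1 \<in> max_ideal" using V.one_mem by (metis ring_on_def partial_object.select_convs(1))
    then show False using res_hom(1) by (simp add: max_ideal_def)
  qed
  fix J assume J: "ideal J (ring_on V)" "max_ideal \<subseteq> J" "J \<subseteq> carrier (ring_on V)"
  show "J = max_ideal \<or> J = carrier (ring_on V)"
  proof (cases "J \<subseteq> max_ideal")
    case False
    then obtain j where j: "j \<in> J" "j \<in> V" "res j \<noteq> 0"
      using J(3) by (auto simp: max_ideal_def ring_on_def)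
    have *: "\<forall>a\<in>J. \<forall>x\<in>V. x * a \<in> J" using J(1) unfolding V.ideal_ring_on_iff by blast
    have "x \<in> J" if "x \<in> V" for x
    proof -
      have "(x * inverse j) * j \<in> J" using * j(1) V.mult_mem[OF that res_nonzero_imp_unit(1)[OF j(2,3)]] by blast
      then show ?thesis using res_nonzero_imp_unit(2)[OF j(2,3)] by (simp add: mult.assoc)
    qed
    then show ?thesis using J(3) by (auto simp: ring_on_def)
  qed (use J in auto)
qed

lemma uniformizer_iff_generates: "uniformizer V \<pi> \<longleftrightarrow> \<pi> \<in> V \<and> {x * \<pi> | x. x \<in> V} = max_ideal"
proof
  assume "uniformizer V \<pi>"
  then have \<pi>: "\<pi> \<in> V" and m: "maximalideal {x * \<pi> | x. x \<in> V} (ring_on V)"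
    by (auto simp: uniformizer_def V.principal_ideal_ring_on)
  let ?I = "{x * \<pi> | x. x \<in> V}"
  interpret maximalideal ?I "ring_on V" by (rule m)
  have "res \<pi> = 0"
  proof (rule ccontr)
    assume n0: "res \<pi> \<noteq> 0"
    have "x \<in> ?I" if "x \<in> V" for x
    proof -
      have "x = (x * inverse \<pi>) * \<pi>" using res_nonzero_imp_unit(2)[OF \<pi> n0] by simp
      then show ?thesis using V.mult_mem[OF that res_nonzero_imp_unit(1)[OF \<pi> n0]] by blast
    qed
    moreover have "?I \<subseteq> V" using V.mult_mem \<pi> by auto
    ultimately show False using I_notcarr by (auto simp: ring_on_def)
  qed
  then have "?I \<subseteq> max_ideal" using \<pi> V.mult_mem by (auto simp: max_ideal_def res_hom)
  moreover have "max_ideal \<subseteq> V" "1 \<notin> max_ideal" using res_hom(1) by (auto simp: max_ideal_def)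
  ultimately have "max_ideal = ?I \<or> max_ideal = V"
    using I_maximal[OF ideal_max_ideal] by (simp add: ring_on_def)
  moreover have "max_ideal \<noteq> V" using \<open>1 \<notin> max_ideal\<close> V.one_mem by metis
  ultimately show "\<pi> \<in> V \<and> ?I = max_ideal" using \<pi> by metis
next
  assume "\<pi> \<in> V \<and> {x * \<pi> | x. x \<in> V} = max_ideal"
  then show "uniformizer V \<pi>"
    using maximalideal_max_ideal by (simp add: uniformizer_def V.principal_ideal_ring_on)
qed

lemma residue_ring_if_uniformizer:
  assumes "uniformizer V \<pi>"
  shows "residue_ring V res \<pi>"
proof
  have \<pi>: "\<pi> \<in> V" "{x * \<pi> | x. x \<in> V} = max_ideal"
    using assms uniformizer_iff_generates by auto
  show "\<pi> \<in> V" by fact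
  show "\<pi> \<noteq> 0"
  proof
    assume "\<pi> = 0"
    then have M: "max_ideal \<subseteq> {0}" using \<pi>(2) by auto
    obtain a where "a \<in> P" "a \<noteq> 0" using nonzero P_closed(1) by blast
    then have "to_fract a \<in> max_ideal" "to_fract a \<noteq> 0"
      using res_eq_0_iff_P by (auto simp: max_ideal_def)
    then show False using M by auto
  qed
  show "res x = 0 \<longleftrightarrow> (\<exists>v\<in>V. x = \<pi> * v)" if "x \<in> V" for x
  proof -
    have "res x = 0 \<longleftrightarrow> x \<in> max_ideal" using that by (simp add: max_ideal_def)
    also have "\<dots> \<longleftrightarrow> (\<exists>v\<in>V. x = \<pi> * v)" unfolding \<pi>(2)[symmetric] by (auto simp: mult.commute)
    finally show ?thesis .
  qed
qed (auto simp: res_hom)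

lemma exists_residue_lift_base: "\<exists>rep. residue_lift D res rep"
proof -
  have "\<exists>z\<in>D. res z = a" for a
  proof -
    obtain v where v: "v \<in> V" "res v = a" using res_surj by blast
    obtain b s where s: "s \<notin> P" "v = to_fract b / to_fract s" using v(1) by (rule localizationE)
    obtain t where t: "1 - s * t \<in> P" using inverse_mod_P[OF s(1)] by blast
    have "res (to_fract (b * t)) = a"
    proof -
      have eq: "to_fract (b * t) + to_fract (1 - s * t) * v = v"
        using not_P_nonzero[OF s(1)] unfolding s(2) by (simp add: field_simps)
      have "res (to_fract (b * t) + to_fract (1 - s * t) * v)
          = res (to_fract (b * t)) + res (to_fract (1 - s * t)) * res v"
        using v(1) to_fract_mem_V V.mult_mem by (simp add: res_hom del: to_fract_mult to_fract_diff)
      moreover have "res (to_fract (1 - s * t)) = 0" using t res_eq_0_iff_P by blast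
      ultimately show ?thesis unfolding eq using v(2) by simp
    qed
    then show ?thesis by blast
  qed
  then have "\<exists>rep. \<forall>a. rep a \<in> D \<and> res (rep a) = a" by (intro choice) blast
  then show ?thesis by (simp add: residue_lift_def)
qed

section \<open>Integrality away from P\<close>

text \<open>
  For a Dedekind domain these are the elements of \<open>K\<close> that are integral at all primes other than
  \<open>P\<close>. The description by powers of elements avoids the factorization of ideals.
\<close>

definition integral_away :: "'d fract set" where
  "integral_away = {z. \<forall>p\<in>P. \<exists>k. to_fract p ^ k * z \<in> D}"

lemma D_subset_integral_away: "D \<subseteq> integral_away"
  unfolding integral_away_def by (auto intro!: exI[of _ 0])

lemma unital_subring_integral_away: "unital_subring integral_away"
proof
  interpret D: unital_subring D by (rule unital_subring_range_to_fract)
  show "1 \<in> integral_away" using D_subset_integral_away D.one_mem by blast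
  fix x y assume xy: "x \<in> integral_away" "y \<in> integral_away"
  have "(\<exists>k. to_fract p ^ k * (x - y) \<in> D) \<and> (\<exists>k. to_fract p ^ k * (x * y) \<in> D)" if "p \<in> P" for p
  proof -
    obtain k l where k: "to_fract p ^ k * x \<in> D" and l: "to_fract p ^ l * y \<in> D"
      using xy \<open>p \<in> P\<close> unfolding integral_away_def by blast
    have p: "to_fract p ^ j \<in> D" for j by (intro D.power_mem) auto
    have "to_fract p ^ (k + l) * (x - y)
      = to_fract p ^ l * (to_fract p ^ k * x) - to_fract p ^ k * (to_fract p ^ l * y)"
      by (simp add: power_add algebra_simps)
    moreover have "\<dots> \<in> D" by (intro D.diff_mem D.mult_mem[OF p k] D.mult_mem[OF p l])
    ultimately have 1: "to_fract p ^ (k + l) * (x - y) \<in> D" by simp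
    have "to_fract p ^ (k + l) * (x * y) = (to_fract p ^ k * x) * (to_fract p ^ l * y)"
      by (simp add: power_add algebra_simps)
    then have "to_fract p ^ (k + l) * (x * y) \<in> D" using D.mult_mem[OF k l] by (simp only:)
    then show ?thesis using 1 by blast
  qed
  then show "x - y \<in> integral_away" "x * y \<in> integral_away" unfolding integral_away_def by blast+
qed

text \<open>
  The denominators of \<open>z\<close> form an ideal. It contains some \<open>s \<notin> P\<close> as well as a power of
  \<open>1 - s t \<in> P\<close>, and these generate the unit ideal.
\<close>

lemma integral_away_Int_localization:
  assumes "z \<in> V" "z \<in> integral_away"
  shows "z \<in> D"
proof -
  interpret D: unital_subring D by (rule unital_subring_range_to_fract)
  obtain a s where s: "s \<notin> P" "z = to_fract a / to_fract s" using assms(1) by (rule localizationE)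
  then have sz: "to_fract s * z \<in> D" using not_P_nonzero by simp
  obtain t where t: "1 - s * t \<in> P" using inverse_mod_P[OF s(1)] by blast
  obtain k where k: "to_fract (1 - s * t) ^ k * z \<in> D"
    using assms(2) t unfolding integral_away_def by blast
  have "\<exists>u. (1 - s * t) ^ j = 1 - s * u" for j
  proof (induction j)
    case 0
    show ?case by (intro exI[of _ 0]) simp
  next
    case (Suc j)
    then obtain u where u: "(1 - s * t) ^ j = 1 - s * u" by blast
    have "(1 - s * t) ^ Suc j = 1 - s * (t + u - t * s * u)"
      unfolding power_Suc u by (simp add: algebra_simps)
    then show ?case by blast
  qed
  then obtain u where u: "(1 - s * t) ^ k = 1 - s * u" by blast
  have "z = to_fract (1 - s * t) ^ k * z + to_fract u * (to_fract s * z)"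
    unfolding to_fract_power[symmetric] u by (simp add: algebra_simps)
  moreover have "to_fract (1 - s * t) ^ k * z + to_fract u * (to_fract s * z) \<in> D"
    by (intro D.add_mem D.mult_mem[OF _ sz] k) auto
  ultimately show ?thesis by simp
qed

text \<open>
  In terms of factorizations: \<open>J = P^k J'\<close> with \<open>J'\<close> not contained in \<open>P\<close>, and \<open>c\<close> is an element of
  \<open>J'\<close> outside \<open>P\<close>. Instead of factoring, consider a maximal counterexample. It is prime, since the
  elements found for two larger ideals \<open>M + (a)\<close> and \<open>M + (b)\<close> multiply to one for \<open>M\<close> if \<open>a b\<close> is in
  \<open>M\<close>. So it is maximal: either it is \<open>P\<close>, or it has an element outside \<open>P\<close>.
\<close>

lemma ideal_contains_power_multiples:
  assumes "ideal J (ring_on UNIV)" "J \<noteq> {0}"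
  shows "\<exists>c. c \<notin> P \<and> (\<forall>p\<in>P. \<exists>k. p ^ k * c \<in> J)"
proof (rule ccontr)
  assume contra: "\<not> ?thesis"
  define good where "good J \<longleftrightarrow> (\<exists>c. c \<notin> P \<and> (\<forall>p\<in>P. \<exists>k. p ^ k * c \<in> J))" for J
  define \<I> where "\<I> = {J. ideal J (ring_on UNIV) \<and> J \<noteq> {0} \<and> \<not> good J}"
  have "J \<in> \<I>" using assms contra by (simp add: \<I>_def good_def)
  then have "\<I> \<noteq> {}" by blast
  moreover have "ideal I (ring_on UNIV)" if "I \<in> \<I>" for I using that by (simp add: \<I>_def)
  ultimately obtain M where M: "M \<in> \<I>" and max: "\<And>I. I \<in> \<I> \<Longrightarrow> M \<subseteq> I \<Longrightarrow> I = M"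
    using noetherian_maximal_element[OF noetherian, of \<I>] by blast
  have MI: "ideal M (ring_on UNIV)" and M0: "M \<noteq> {0}" and Mg: "\<not> good M"
    using M by (auto simp: \<I>_def)
  have Mc: "0 \<in> M" "\<And>a b. a \<in> M \<Longrightarrow> b \<in> M \<Longrightarrow> a + b \<in> M" "\<And>a x. a \<in> M \<Longrightarrow> x * a \<in> M"
    using ideal_UNIV_D[OF MI] by auto
  have M1: "1 \<notin> M"
  proof
    assume "1 \<in> M"
    then have "p ^ 0 * 1 \<in> M" for p by simp
    then have "good M" unfolding good_def using not_P(1) by blast
    then show False using Mg by simp
  qed
  have ext: "\<exists>c. c \<notin> P \<and> (\<forall>p\<in>P. \<exists>k x. p ^ k * c - x * a \<in> M)" if a: "a \<notin> M" for a
  proof -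
    define I where "I = {m + x * a | m x. m \<in> M}"
    have II: "m + x * a \<in> I" if "m \<in> M" for m x using that by (auto simp: I_def)
    have "ideal I (ring_on UNIV)" unfolding ideal_UNIV_iff
    proof (intro conjI ballI allI)
      show "0 \<in> I" using II[OF Mc(1), of 0] by simp
    next
      fix u v assume "u \<in> I" "v \<in> I"
      then obtain m x m' x' where x: "u = m + x * a" "v = m' + x' * a" "m \<in> M" "m' \<in> M"
        by (auto simp: I_def)
      have "u + v = (m + m') + (x + x') * a" by (simp add: x algebra_simps)
      then show "u + v \<in> I" using II Mc(2)[OF x(3,4)] by metis
    next
      fix u z assume "u \<in> I"
      then obtain m x where x: "u = m + x * a" "m \<in> M" by (auto simp: I_def)
      have "z * u = z * m + (z * x) * a" by (simp add: x algebra_simps)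
      then show "z * u \<in> I" using II Mc(3)[OF x(2)] by metis
    qed
    moreover have "M \<subseteq> I" using II[of _ 0] by auto
    moreover have "a \<in> I" using II[OF Mc(1), of 1] by simp
    ultimately have "good I" using max[of I] a Mc(1) by (auto simp: \<I>_def)
    then obtain c where c: "c \<notin> P" "\<And>p. p \<in> P \<Longrightarrow> \<exists>k. p ^ k * c \<in> I" by (auto simp: good_def)
    have "\<exists>k x. p ^ k * c - x * a \<in> M" if "p \<in> P" for p
    proof -
      obtain k where "p ^ k * c \<in> I" using c(2)[OF \<open>p \<in> P\<close>] by blast
      then obtain m x where "p ^ k * c = m + x * a" "m \<in> M" by (auto simp: I_def)
      then have "p ^ k * c - x * a \<in> M" by simp
      then show ?thesis by blast
    qed
    then show ?thesis using c(1) by blast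
  qed
  have "primeideal M (ring_on UNIV)"
  proof (rule primeidealI[OF MI unital_subring.cring_ring_on[OF unital_subring_UNIV]])
    show "carrier (ring_on UNIV) \<noteq> M" using M1 by (auto simp: ring_on_def)
    fix a b assume "a \<otimes>\<^bsub>ring_on UNIV\<^esub> b \<in> M"
    then have ab: "a * b \<in> M" by (simp add: ring_on_def)
    show "a \<in> M \<or> b \<in> M"
    proof (rule ccontr)
      assume "\<not> (a \<in> M \<or> b \<in> M)"
      then obtain c c' where c: "c \<notin> P" "\<And>p. p \<in> P \<Longrightarrow> \<exists>k x. p ^ k * c - x * a \<in> M"
        and c': "c' \<notin> P" "\<And>p. p \<in> P \<Longrightarrow> \<exists>k x. p ^ k * c' - x * b \<in> M"
        using ext by metis
      have "\<exists>k. p ^ k * (c * c') \<in> M" if "p \<in> P" for p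
      proof -
        obtain k x l y where k: "p ^ k * c - x * a \<in> M" and l: "p ^ l * c' - y * b \<in> M"
          using c(2)[OF \<open>p \<in> P\<close>] c'(2)[OF \<open>p \<in> P\<close>] by blast
        have "p ^ (k + l) * (c * c') = (p ^ l * c') * (p ^ k * c - x * a)
            + ((x * a) * (p ^ l * c' - y * b) + (x * y) * (a * b))"
          by (simp add: power_add algebra_simps)
        also have "\<dots> \<in> M" by (intro Mc(2) Mc(3)[OF k] Mc(3)[OF l] Mc(3)[OF ab])
        finally show ?thesis by blast
      qed
      then have "good M" unfolding good_def using not_P(2)[OF c(1) c'(1)] by blast
      then show False using Mg by simp
    qed
  qed
  then have maxM: "maximalideal M (ring_on UNIV)" using M0 by (rule prime_imp_maximal)
  show False
  proof (cases "M \<subseteq> P")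
    case True
    interpret maximalideal M "ring_on UNIV" by (rule maxM)
    have "P = M \<or> P = UNIV"
      using I_maximal[OF primeideal_UNIV_D(1)[OF prime] True] by (simp add: ring_on_def)
    then have "P = M" using not_P(1) by auto
    then have "p ^ 1 * 1 \<in> M" if "p \<in> P" for p using that by simp
    then have "good M" unfolding good_def using not_P(1) by blast
    then show False using Mg by simp
  next
    case False
    then obtain c where "c \<in> M" "c \<notin> P" by auto
    then have "p ^ 0 * c \<in> M" for p by simp
    then have "good M" unfolding good_def using \<open>c \<notin> P\<close> by blast
    then show False using Mg by simp
  qed
qed

lemma clear_denominator: "\<exists>c. c \<notin> P \<and> to_fract c * y \<in> integral_away"
proof -
  obtain a b where y: "y = to_fract a / to_fract b" "b \<noteq> 0"
    by (cases y) (auto simp: Fract_conv_to_fract)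
  let ?J = "{x * b | x. x \<in> UNIV}"
  have 1: "1 * b \<in> ?J" by blast
  have "ideal ?J (ring_on UNIV)"
    using cring.cgenideal_ideal[OF unital_subring.cring_ring_on[OF unital_subring_UNIV], of b]
    by (simp add: unital_subring.principal_ideal_ring_on[OF unital_subring_UNIV]) (simp add: ring_on_def)
  moreover have "?J \<noteq> {0}" using 1 y(2) by auto
  ultimately obtain c where c: "c \<notin> P" "\<And>p. p \<in> P \<Longrightarrow> \<exists>k. p ^ k * c \<in> ?J"
    using ideal_contains_power_multiples by blast
  have "\<exists>k. to_fract p ^ k * (to_fract c * y) \<in> D" if "p \<in> P" for p
  proof -
    obtain k x where k: "p ^ k * c = x * b" using c(2)[OF \<open>p \<in> P\<close>] by blast
    have "to_fract p ^ k * (to_fract c * y) = to_fract (p ^ k * c) * y"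
      by (simp add: to_fract_power mult.assoc)
    also have "\<dots> = to_fract (x * a)" unfolding k y(1) using y(2) by simp
    finally show ?thesis by blast
  qed
  then show ?thesis using c(1) unfolding integral_away_def by blast
qed

lemma clear_denominators: "\<exists>c. c \<notin> P \<and> smult (to_fract c) f \<in> polys_over integral_away"
proof (induction f)
  case 0
  show ?case using not_P(1) unital_subring.zero_mem[OF unital_subring_integral_away]
    by (auto simp: polys_over_def)
next
  case (pCons a f)
  interpret W: unital_subring integral_away by (rule unital_subring_integral_away)
  obtain c d where c: "c \<notin> P" "to_fract c * a \<in> integral_away"
    and d: "d \<notin> P" "smult (to_fract d) f \<in> polys_over integral_away"
    using clear_denominator pCons.IH by blast
  have D: "to_fract x \<in> integral_away" for x using D_subset_integral_away by auto
  have "to_fract d * (to_fract c * a) \<in> integral_away" by (intro W.mult_mem D c)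
  moreover have "smult (to_fract c) (smult (to_fract d) f) \<in> polys_over integral_away"
    by (intro W.smult_polys_over D d)
  ultimately have "smult (to_fract (c * d)) (pCons a f) \<in> polys_over integral_away"
    using W.pCons_polys_over by (simp add: mult_ac)
  then show ?case using not_P(2)[OF c(1) d(1)] by blast
qed

end

section \<open>Proper integrality\<close>

lemma integral_over_if_monic_value:
  assumes "unital_subring R" and f: "f \<in> polys_over R" "lead_coeff f = 1" "degree f \<noteq> 0"
    and x: "poly f x \<in> R"
  shows "integral_over R x"
proof -
  interpret unital_subring R by fact
  interpret polys: unital_subring "polys_over R" by (rule unital_subring_polys_over)
  let ?g = "f - [:poly f x:]"
  have "coeff ?g (degree f) = coeff f (degree f)"
    using f(3) by (cases "degree f") simp_all
  then have lead: "coeff ?g (degree f) = 1" by (simp only: f(2))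
  have "degree ?g = degree f"
  proof (rule antisym)
    show "degree ?g \<le> degree f" by (rule degree_diff_le) simp_all
    show "degree f \<le> degree ?g" by (rule le_degree) (simp only: lead, simp)
  qed
  then have "lead_coeff ?g = 1" using lead by (simp only:)
  moreover have "?g \<in> polys_over R" using f(1) x by (intro polys.diff_mem) auto
  ultimately show ?thesis unfolding integral_over_def
    by (intro exI[of _ ?g]) (auto simp: polys_over_def)
qed

lemma unital_subring_image_to_fract:
  assumes "unital_subring S" shows "unital_subring (to_fract ` S)"
proof -
  interpret unital_subring S by fact
  show ?thesis
    by unfold_locales
      (auto simp flip: to_fract_1 to_fract_diff to_fract_mult simp del: to_fract_1 intro: diff_mem mult_mem)
qed

lemma unital_subring_INT:
  assumes "\<And>i. i \<in> I \<Longrightarrow> unital_subring (S i)"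
  shows "unital_subring (\<Inter>i\<in>I. S i)"
  using assms[THEN unital_subring.one_mem] assms[THEN unital_subring.diff_mem]
    assms[THEN unital_subring.mult_mem]
  by unfold_locales auto

lemma unital_subring_Int_mat: "unital_subring (Int_mat n)"
proof -
  interpret D: unital_subring "range to_fract" by (rule unital_subring_range_to_fract)
  have *: "Int_mat n = (\<Inter>A\<in>matrices_over n (range to_fract).
      {f. eval_mat f A \<in> matrices_over n (range to_fract)})"
    by (auto simp: Int_mat_def)
  show ?thesis unfolding * by (intro unital_subring_INT D.unital_subring_integral_at)
qed

lemma const_Int_mat: "[:to_fract a:] \<in> Int_mat n"
proof -
  interpret D: unital_subring "range to_fract" by (rule unital_subring_range_to_fract)
  show ?thesis unfolding Int_mat_def by (auto intro!: D.polys_over_integral_at)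
qed

text \<open>
  The coefficient is an entry of the value of \<open>f\<close> at the nilpotent Jordan block.
\<close>

lemma coeff_mem_if_Int_mat:
  fixes f :: "'d::idom fract poly"
  assumes f: "f \<in> Int_mat n" and i: "i < n"
  shows "coeff f i \<in> range to_fract"
proof -
  define N :: "'d fract mat" where "N = mat n n (\<lambda>(i, j). if j = Suc i then 1 else 0)"
  have N: "N \<in> carrier_mat n n" by (simp add: N_def)
  have "1 = to_fract 1" "0 = to_fract 0" by simp_all
  then have "N \<in> matrices_over n (range to_fract)"
    by (auto simp: matrices_over_iff N_def simp del: to_fract_1 to_fract_0)
  then have E: "eval_mat f N \<in> matrices_over n (range to_fract)" using f by (simp add: Int_mat_def)
  have pw: "(N ^\<^sub>m k) $$ (a, b) = (if b = a + k then 1 else 0)" if "a < n" "b < n" for a b k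
    using that
  proof (induction k arbitrary: b)
    case 0
    then show ?case using N by simp
  next
    case (Suc k)
    have "(N ^\<^sub>m Suc k) $$ (a, b) = (\<Sum>l<n. (N ^\<^sub>m k) $$ (a, l) * N $$ (l, b))"
      using Suc.prems N pow_carrier_mat[OF N, of k]
      by (auto simp: scalar_prod_def lessThan_atLeast0 intro!: sum.cong)
    also have "\<dots> = (\<Sum>l<n. if l = a + k then (if b = Suc l then 1 else 0) else 0)"
      using Suc by (intro sum.cong) (auto simp: N_def)
    also have "\<dots> = (if b = a + Suc k then 1 else 0)" using Suc.prems by auto
    finally show ?case .
  qed
  have "eval_mat f N $$ (0, i) = (\<Sum>k\<le>max i (degree f). coeff f k * (N ^\<^sub>m k) $$ (0, i))"
    using N i by (intro eval_mat_index) auto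
  also have "\<dots> = (\<Sum>k\<le>max i (degree f). if k = i then coeff f k else 0)"
    using i by (intro sum.cong) (auto simp: pw)
  also have "\<dots> = coeff f i" by simp
  finally have "eval_mat f N $$ (0, i) = coeff f i" .
  moreover have "0 < n" using i by simp
  then have "eval_mat f N $$ (0, i) \<in> range to_fract"
    using E i unfolding matrices_over_iff by blast
  ultimately show ?thesis by (simp only:)
qed

lemma numerator_polys_over:
  assumes "unital_subring S" "\<pi> \<in> S" "residue_lift S res rep" "residue_poly_lift S res prep"
  shows "H_poly n \<pi> rep * theta_poly n prep ^ k \<in> polys_over S"
proof -
  interpret unital_subring S by fact
  interpret polys: unital_subring "polys_over S" by (rule unital_subring_polys_over)
  have rep: "rep a \<in> S" for a using assms by (auto simp: residue_lift_def)
  have prep: "prep f \<in> polys_over S" for f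
    using assms by (auto simp: residue_poly_lift_def polys_over_def)
  have "h_poly n \<pi> rep \<in> polys_over S"
    unfolding h_poly_def using assms(2) rep
    by (auto intro!: polys.mult_mem polys.prod_mem polys.add_mem monom_polys_over mult_mem)
  then have "H_poly n \<pi> rep \<in> polys_over S"
    unfolding H_poly_def using rep
    by (auto intro!: polys.prod_mem pcompose_polys_over pCons_polys_over uminus_mem)
  moreover have "theta_poly n prep \<in> polys_over S"
    unfolding theta_poly_def by (intro polys.prod_mem polys.power_mem prep)
  ultimately show ?thesis by (intro polys.mult_mem polys.power_mem)
qed

context residue_at_prime
begin

text \<open>
  The equation of \<open>cF\<close> is \<open>\<psi>(X) - \<psi>(cF) = 0\<close>, with \<open>\<psi>\<close> called \<open>f\<close> and \<open>\<psi>(cF)\<close> called \<open>g\<close>.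
\<close>

lemma properly_integral_if_integral_away:
  assumes \<pi>: "uniformizer V \<pi>" and rep: "residue_lift V res rep"
    and prep: "residue_poly_lift V res prep" and n: "2 \<le> n" and c: "c \<notin> P"
    and away: "smult (to_fract c) (F_poly n \<pi> rep prep) \<in> polys_over integral_away"
  shows "properly_integral_Int_mat n (smult (to_fract c) (F_poly n \<pi> rep prep))"
proof -
  interpret V: unital_subring V by (rule unital_subring_V)
  interpret W: unital_subring integral_away by (rule unital_subring_integral_away)
  interpret WX: unital_subring "polys_over integral_away" by (rule W.unital_subring_polys_over)
  interpret residue_ring V res \<pi> by (rule residue_ring_if_uniformizer[OF \<pi>])
  interpret residue_lifts V res \<pi> rep prep n by unfold_locales fact+
  define B where "B = smult (to_fract c) (F_poly n \<pi> rep prep)"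
  obtain rep' where rep': "residue_lift D res rep'" using exists_residue_lift_base by blast
  have rep'_D: "rep' a \<in> D" for a using rep' by (simp add: residue_lift_def)
  have rep'_V: "residue_lift V res rep'" using rep' D_subset_V unfolding residue_lift_def by blast
  define g where "g = (\<Prod>(r, s)\<in>UNIV. (B\<^sup>2 - [:rep' r:] * B - [:rep' s:]) ^ n)"
  have g_away: "g \<in> polys_over integral_away"
    unfolding g_def using away subsetD[OF D_subset_integral_away rep'_D] unfolding B_def[symmetric]
    by (auto intro!: WX.prod_mem WX.power_mem WX.diff_mem WX.mult_mem simp del: mult_pCons_left)
  have "g \<in> Int_mat n" unfolding Int_mat_def
  proof (intro CollectI ballI)
    fix A assume "A \<in> matrices_over n D"
    then have A_V: "A \<in> matrices_over n V" and A_W: "A \<in> matrices_over n integral_away"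
      using D_subset_V D_subset_integral_away unfolding matrices_over_iff by blast+
    have A: "A \<in> carrier_mat n n" using A_V by (simp add: matrices_over_iff)
    interpret integral_at V res \<pi> rep prep n "{f. eval_mat f A \<in> matrices_over n V}" "char_poly A"
    proof (intro integral_at.intro integral_at_axioms.intro residue_lifts_axioms)
      show "unital_subring {f. eval_mat f A \<in> matrices_over n V}"
        by (rule V.unital_subring_integral_at[OF A_V])
      show "polys_over V \<subseteq> {f. eval_mat f A \<in> matrices_over n V}"
        using V.polys_over_integral_at[OF A_V] by auto
      show "char_poly A \<in> polys_over V" by (rule V.char_poly_polys_over[OF A_V])
      show "lead_coeff (char_poly A) = 1" "degree (char_poly A) = n"
        using degree_monic_char_poly[OF A] by auto
      show "char_poly A * f \<in> {f. eval_mat f A \<in> matrices_over n V}" for f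
        using left_mult_zero_mat[OF eval_mat_carrier[OF A, of f]]
        by (simp add: eval_mat_mult[OF A] cayley_hamilton[OF A] matrices_over_iff)
    qed
    have "g \<in> {f. eval_mat f A \<in> matrices_over n V}"
      unfolding g_def B_def by (rule F_poly_root_mod_\<Phi>[OF rep'_V]) simp
    moreover have "eval_mat g A \<in> matrices_over n integral_away"
      by (rule W.polys_over_integral_at[OF A_W g_away])
    ultimately show "eval_mat g A \<in> matrices_over n D"
      using integral_away_Int_localization by (simp add: matrices_over_iff)
  qed
  define R :: "'d fract poly fract set" where "R = to_fract ` Int_mat n"
  interpret R: unital_subring R
    unfolding R_def by (rule unital_subring_image_to_fract[OF unital_subring_Int_mat])
  interpret RX: unital_subring "polys_over R" by (rule R.unital_subring_polys_over)
  define quad where "quad r s = [:- to_fract [:rep' s:], - to_fract [:rep' r:], 1:]" for r s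
  define f where "f = (\<Prod>(r, s)\<in>UNIV. quad r s ^ n)"
  have "integral_over R (to_fract B)"
  proof (rule integral_over_if_monic_value)
    show "unital_subring R" by (rule R.unital_subring_axioms)
    have "to_fract [:rep' a:] \<in> R" for a
      using rep'_D[of a] by (auto simp: R_def intro!: imageI const_Int_mat)
    then show "f \<in> polys_over R"
      unfolding f_def quad_def
      by (auto intro!: RX.prod_mem RX.power_mem R.pCons_polys_over R.uminus_mem)
    show "lead_coeff f = 1"
      unfolding f_def quad_def lead_coeff_prod by (intro prod.neutral) (auto simp: lead_coeff_power)
    have "degree f = (\<Sum>(r, s)\<in>(UNIV :: ('f \<times> 'f) set). degree (quad r s ^ n))"
      unfolding f_def by (subst degree_prod_eq_sum_degree) (auto simp: quad_def case_prod_beta)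
    also have "\<dots> = (\<Sum>_\<in>(UNIV :: ('f \<times> 'f) set). n * 2)"
      by (intro sum.cong) (auto simp: degree_power_eq quad_def)
    also have "\<dots> \<noteq> 0" using n by simp
    finally show "degree f \<noteq> 0" .
    have "poly f (to_fract B) = to_fract g"
      unfolding f_def g_def to_fract_prod poly_prod
      by (intro prod.cong refl)
         (auto simp: quad_def to_fract_power power2_eq_square algebra_simps simp del: mult_pCons_left
            simp flip: to_fract_mult)
    then show "poly f (to_fract B) \<in> R" using \<open>g \<in> Int_mat n\<close> by (simp add: R_def)
  qed
  moreover have "B \<notin> Int_mat n"
  proof
    assume "B \<in> Int_mat n"
    then have "coeff B (n - 1) \<in> D" using n by (intro coeff_mem_if_Int_mat[of _ n]) auto
    moreover have "coeff B (n - 1) \<notin> V"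
      unfolding B_def using c by (intro F_poly_not_integral) (auto simp: res_eq_0_iff_P)
    ultimately show False using D_subset_V by blast
  qed
  ultimately show ?thesis unfolding properly_integral_Int_mat_def B_def R_def by blast
qed

lemma uniformizer_generator:
  assumes p: "P = {x * p | x. x \<in> UNIV}"
  shows "uniformizer V (to_fract p)"
  unfolding uniformizer_iff_generates
proof (intro conjI to_fract_mem_V equalityI subsetI)
  interpret V: unital_subring V by (rule unital_subring_V)
  have "1 * p \<in> P" unfolding p by blast
  then have res_p: "res (to_fract p) = 0" using res_eq_0_iff_P by simp
  fix z assume "z \<in> {x * to_fract p | x. x \<in> V}"
  then show "z \<in> max_ideal" using res_p V.mult_mem by (auto simp: max_ideal_def res_hom)
next
  fix z assume "z \<in> max_ideal"
  then obtain a s where a: "a \<in> P" "s \<notin> P" "z = to_fract a / to_fract s"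
    using max_ideal_eq_fractions by blast
  obtain x where "a = x * p" using a(1) p by blast
  then have "z = to_fract x / to_fract s * to_fract p" using a(3) by simp
  then show "z \<in> {x * to_fract p | x. x \<in> V}" using localizationI[OF a(2)] by blast
qed

lemma F_poly_integral_away:
  assumes p: "P = {x * p | x. x \<in> UNIV}"
    and rep: "residue_lift D res rep" and prep: "residue_poly_lift D res prep"
  shows "F_poly n (to_fract p) rep prep \<in> polys_over integral_away"
  unfolding polys_over_def
proof (intro CollectI allI)
  interpret D: unital_subring D by (rule unital_subring_range_to_fract)
  fix i
  let ?q = "CARD('f)"
  define d where "d = coeff (H_poly n (to_fract p) rep * theta_poly n prep ^ ?q) i"
  have d: "d \<in> D"
    unfolding d_def by (intro D.coeff_polys_over numerator_polys_over[OF unital_subring_range_to_fract _ rep prep]) simp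
  have p0: "p \<noteq> 0" using p nonzero by auto
  have eq: "coeff (F_poly n (to_fract p) rep prep) i = d / to_fract p ^ ?q"
    by (simp add: F_poly_def d_def)
  have "to_fract y ^ ?q * (d / to_fract p ^ ?q) \<in> D" if "y \<in> P" for y
  proof -
    obtain x where "y = x * p" using \<open>y \<in> P\<close> p by blast
    then have "to_fract y ^ ?q * (d / to_fract p ^ ?q) = to_fract x ^ ?q * d"
      using p0 by (simp add: power_mult_distrib)
    then show ?thesis using D.mult_mem[OF D.power_mem d] by simp
  qed
  then show "coeff (F_poly n (to_fract p) rep prep) i \<in> integral_away"
    unfolding integral_away_def eq by blast
qed

lemma exists_choices_in_base:
  assumes p: "P = {x * p | x. x \<in> UNIV}"
  shows "\<exists>\<pi> rep prep. uniformizer V \<pi> \<and> choices_in_base P res \<pi> rep prep"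
proof -
  interpret D: unital_subring D by (rule unital_subring_range_to_fract)
  obtain rep where rep: "residue_lift D res rep" using exists_residue_lift_base by blast
  define prep where "prep f = map_poly (\<lambda>a. if a = 0 then 0 else rep a) f" for f
  have "residue_poly_lift D res prep"
    unfolding residue_poly_lift_def prep_def
    using rep res_zero by (auto simp: coeff_map_poly residue_lift_def)
  then have "choices_in_base P res (to_fract p) rep prep"
    using rep p unfolding choices_in_base_def
      unital_subring.principal_ideal_ring_on[OF unital_subring_UNIV] by blast
  then show ?thesis using uniformizer_generator[OF p] by blast
qed

end

theorem theorem3p3:
  fixes P :: "'d::idom set"
    and n :: nat
    and res :: "'d fract \<Rightarrow> 'f::{field,finite}"
  assumes "dedekind_domain TYPE('d)"
    and "finite_residue_fields TYPE('d)"
    and "n \<ge> 2"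
    and "primeideal P (ring_on UNIV)"
    and "P \<noteq> {0}"
    and "residue_map (localization_at P) res"
  shows "(\<forall>\<pi> rep prep.
            uniformizer (localization_at P) \<pi> \<and>
            residue_lift (localization_at P) res rep \<and>
            residue_poly_lift (localization_at P) res prep \<longrightarrow>
            (\<exists>c. c \<notin> P \<and>
               properly_integral_Int_mat n (smult (to_fract c) (F_poly n \<pi> rep prep)))) \<and>
         (principalideal P (ring_on UNIV) \<longrightarrow>
            (\<exists>\<pi> rep prep. uniformizer (localization_at P) \<pi> \<and>
               choices_in_base P res \<pi> rep prep) \<and>
            (\<forall>\<pi> rep prep. choices_in_base P res \<pi> rep prep \<longrightarrow>
               properly_integral_Int_mat n (F_poly n \<pi> rep prep)))"
proof -
  interpret residue_at_prime P res by (rule residue_at_prime.intro[OF assms(1,4,5,6)])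
  show ?thesis
  proof (intro conjI impI allI)
    fix \<pi> rep prep
    assume choice: "uniformizer (localization_at P) \<pi> \<and> residue_lift (localization_at P) res rep \<and>
      residue_poly_lift (localization_at P) res prep"
    obtain c where "c \<notin> P" "smult (to_fract c) (F_poly n \<pi> rep prep) \<in> polys_over integral_away"
      using clear_denominators by blast
    then show "\<exists>c. c \<notin> P \<and> properly_integral_Int_mat n (smult (to_fract c) (F_poly n \<pi> rep prep))"
      using properly_integral_if_integral_away[of \<pi> rep prep n c] choice assms(3) by blast
  next
    assume "principalideal P (ring_on UNIV)"
    then interpret principalideal P "ring_on UNIV" .
    obtain p where "P = Idl\<^bsub>ring_on UNIV\<^esub> {p}" using generate by (auto simp: ring_on_def)
    then have "P = PIdl\<^bsub>ring_on UNIV\<^esub> p"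
      using cring.cgenideal_eq_genideal[OF unital_subring.cring_ring_on[OF unital_subring_UNIV], of p]
      by (simp add: ring_on_def)
    then show "\<exists>\<pi> rep prep. uniformizer (localization_at P) \<pi> \<and> choices_in_base P res \<pi> rep prep"
      using exists_choices_in_base[of p]
      by (simp add: unital_subring.principal_ideal_ring_on[OF unital_subring_UNIV])
  next
    fix \<pi> rep prep
    assume "choices_in_base P res \<pi> rep prep"
    then obtain p where p: "P = {x * p | x. x \<in> UNIV}" "\<pi> = to_fract p"
      and lifts: "residue_lift D res rep" "residue_poly_lift D res prep"
      unfolding choices_in_base_def unital_subring.principal_ideal_ring_on[OF unital_subring_UNIV]
      by blast
    have "residue_lift V res rep" "residue_poly_lift V res prep"
      using lifts D_subset_V unfolding residue_lift_def residue_poly_lift_def by blast+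
    then have "properly_integral_Int_mat n (smult (to_fract 1) (F_poly n \<pi> rep prep))"
      using F_poly_integral_away[OF p(1) lifts, of n] uniformizer_generator[OF p(1)] not_P(1) assms(3)
      unfolding p(2) by (intro properly_integral_if_integral_away) simp_all
    then show "properly_integral_Int_mat n (F_poly n \<pi> rep prep)" by simp
  qed
qed

end
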